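(* For permutations $u,v\in S_n$, \[\mathcal{T}_{u,v}=\{F_\bullet\in\mathrm{Fl}_n:\Delta_w(F_\bullet)=0\text{ for all }w\notin[u,v]\},\qquad \mathcal{T}^\circ_{u,v}=\mathcal{T}_{u,v}\cap\{\Delta_u\Delta_v\neq 0\}.\]
   Context: $\mathrm{Fl}_n$ is the variety of complete flags $F_\bullet$ in $\mathbb{C}^n$; a flag is represented by an invertible matrix $M$ whose first $k$ columns span $F_k$. For $S\subseteq[n]$, $\mathrm{rank}_S(F_k)$ is the rank of the submatrix of $M$ with rows $S$ and the first $k$ columns. For distinct $i_1,\dots,i_k$, $\Delta_{i_1,\dots,i_k}(F_\bullet)$ is the determinant of the submatrix of $M$ with rows $i_1,\dots,i_k$ (in this order) and the first $k$ columns (defined up to a common scalar for each $k$). For $w\in S_n$ (one-line notation, $w[k]:=\{w_1,\dots,w_k\}$), the multi-Plücker coordinate is $\Delta_w(F_\bullet):=\prod_{k=1}^n\Delta_{w_1,\dots,w_k}(F_\bullet)$. Cyclic interval $[a,b)_c$: $\{a,\dots,b-1\}$ if $a\le b$ (empty if $a=b$), $\{a,\dots,n\}\cup\{1,\dots,b-1\}$ if $a>b$. For $r\in[n]$, $<_r$ is the total order $r<_r r+1<_r\cdots<_r n<_r1<_r\cdots<_r r-1$; for $k$-subsets $A=\{a_1<_r\cdots<_r a_k\}$, $B=\{b_1<_r\cdots<_r b_k\}$, $A\le_r B$ iff $a_i\le_r b_i$ for all $i$. For $\mathbf{a}\in[n]^n$, $u\le_{\mathbf{a}}v$ iff $u[k]\le_{a_k}v[k]$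 for all $k$; such $\mathbf{a}$ always exists. $\mathcal{T}_{u,v}$ (tilted Richardson variety) is the set of flags with $\mathrm{rank}_{[a_k,i)_c}(F_k)\le|u[k]\cap[a_k,i)_c|$ and $\mathrm{rank}_{[i,a_k)_c}(F_k)\le|v[k]\cap[i,a_k)_c|$ for all $i,k\in[n]$, and $\mathcal{T}^\circ_{u,v}$ is defined with equalities, for any $\mathbf{a}$ with $u\le_{\mathbf{a}}v$ (the result does not depend on this choice). Quantum Bruhat graph $\Gamma_n$: directed graph on $S_n$ with an edge $w\to wt_{ij}$ ($i<j$, $wt_{ij}$ swaps positions $i,j$) whenever $\ell(wt_{ij})=\ell(w)+1$ or $\ell(wt_{ij})=\ell(w)+1-2(j-i)$, $\ell$ = number of inversions; $\ell(x,y)$ = shortest path length from $x$ to $y$; tilted Bruhat interval $[u,v]:=\{w:\ell(u,w)+\ell(w,v)=\ell(u,v)\}$. *)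

theory Defs
  imports
    "Jordan_Normal_Form.DL_Rank_Submatrix"
    "HOL-Combinatorics.Permutations"
begin

text \<open>
  Elements of \<open>[n]\<close> are the naturals \<open>1, \<dots>, n\<close>, and \<open>S\<^sub>n\<close> is the set of \<open>w\<close> with
  \<open>w permutes {1..n}\<close>, so that \<open>w k\<close> is the \<open>k\<close>-th letter of the one-line notation. Matrix rows and
  columns of the library are numbered from \<open>0\<close>: row \<open>i \<in> [n]\<close> has index \<open>i - 1\<close>.
\<close>

section \<open>Complete flags\<close>

text \<open>
  Flags are extensional functions on \<open>{0..n}\<close>, so that distinct functions are distinct flags.
\<close>

definition complete_flags :: "nat \<Rightarrow> (nat \<Rightarrow> complex vec set) set" where
  "complete_flags n = {F \<in> extensional {0..n}.
     (\<forall>k\<le>n. VectorSpace.subspace class_ring (F k) (module_vec TYPE(complex) n) \<and>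
             vectorspace.dim class_ring ((module_vec TYPE(complex) n)\<lparr>carrier := F k\<rparr>) = k) \<and>
     (\<forall>k<n. F k \<subseteq> F (Suc k))}"

definition represents :: "nat \<Rightarrow> complex mat \<Rightarrow> (nat \<Rightarrow> complex vec set) \<Rightarrow> bool" where
  "represents n M F \<longleftrightarrow> M \<in> carrier_mat n n \<and> invertible_mat M \<and>
     (\<forall>k\<le>n. F k = vec_space.col_space n (submatrix M UNIV {..<k}))"

lemma represents_ex:
  assumes "F \<in> complete_flags n"
  shows "\<exists>M. represents n M F"
proof -
  interpret vec_space "TYPE(complex)" n .
  have sub: "VectorSpace.subspace class_ring (F k) V"
    and dim: "vectorspace.dim class_ring (vs (F k)) = k" if "k \<le> n" for k
    using assms that by (auto simp: complete_flags_def)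
  have mono: "F k \<subseteq> F (Suc k)" if "k < n" for k
    using assms that by (auto simp: complete_flags_def)
  have basis: "span B = F k"
    if "k \<le> n" "finite B" "B \<subseteq> F k" "lin_indpt B" "card B = k" for k B
  proof -
    interpret W: vectorspace class_ring "vs (F k)"
      using subspace_is_vs[OF sub[OF that(1)]] .
    have sm: "submodule class_ring (F k) V" using sub[OF that(1)] by (simp add: VectorSpace.subspace_def)
    have small: "finite A \<and> card A \<le> dim" if "A \<subseteq> carrier (vs (F k)) \<and> W.lin_indpt A" for A
    proof -
      have "A \<subseteq> F k" "A \<subseteq> carrier V" using that sm by (auto simp: submodule_def)
      moreover have "lin_indpt A" using that span_li_not_depend(2)[OF \<open>A \<subseteq> F k\<close> sm] by simp
      ultimately show ?thesis using li_le_dim[OF fin_dim, of A] by simp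
    qed
    have "\<exists>A. finite A \<and> maximal A (\<lambda>S. S \<subseteq> carrier (vs (F k)) \<and> W.lin_indpt S)"
    proof (rule maximal_exists[where N = dim and B = "{}"])
      show "{} \<subseteq> carrier (vs (F k)) \<and> W.lin_indpt {}"
        unfolding W.lin_dep_def by blast
    qed (rule small)
    then obtain A where "finite A" "maximal A (\<lambda>S. S \<subseteq> carrier (vs (F k)) \<and> W.lin_indpt S)"
      by blast
    then have "W.basis A" by (intro W.max_li_is_basis)
    with \<open>finite A\<close> have "W.fin_dim"
      unfolding W.fin_dim_def W.basis_def by blast
    moreover have "W.lin_indpt B" using that(4) span_li_not_depend(2)[OF that(3) sm] by simp
    ultimately have "W.basis B"
      by (intro W.dim_li_is_basis) (use that dim in auto)
    then have "W.span B = F k" by (simp add: W.basis_def)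
    then show ?thesis using span_li_not_depend(1)[OF that(3) sm] by simp
  qed
  have carr: "F k \<subseteq> carrier_vec n" if "k \<le> n" for k
    using sub[OF that] by (auto simp: VectorSpace.subspace_def submodule_def)
  have "\<exists>bs. length bs = k \<and> distinct bs \<and> lin_indpt (set bs) \<and>
          (\<forall>j\<le>k. set (take j bs) \<subseteq> F j)" if "k \<le> n" for k
    using that
  proof (induction k)
    case 0
    show ?case by (intro exI[of _ "[]"]) (auto simp: lin_dep_def)
  next
    case (Suc k)
    then obtain bs where bs: "length bs = k" "distinct bs" "lin_indpt (set bs)"
      "\<And>j. j \<le> k \<Longrightarrow> set (take j bs) \<subseteq> F j" by auto
    have sp: "span (set bs) = F k"
      using bs(1,2,3) bs(4)[of k] Suc.prems by (intro basis) (auto simp: distinct_card)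
    have "F k \<noteq> F (Suc k)" using dim[of k] dim[of "Suc k"] Suc.prems by force
    then obtain b where b: "b \<in> F (Suc k)" "b \<notin> F k" using mono[of k] Suc.prems by auto
    have c: "set bs \<subseteq> carrier_vec n" "b \<in> carrier_vec n"
      using bs(1) bs(4)[of k] b carr[of k] carr[of "Suc k"] Suc.prems by auto
    have nb: "b \<notin> set bs" using b bs(4)[of k] bs(1) by auto
    have "lin_indpt (set bs \<union> {b})"
      using lin_dep_iff_in_span[of "set bs" b] c bs(3) nb sp b by auto
    moreover have "set (take j (bs @ [b])) \<subseteq> F j" if "j \<le> Suc k" for j
      using that bs(1) bs(4)[of j] bs(4)[of k] mono[of k] b Suc.prems
      by (cases "j = Suc k") auto
    ultimately show ?case using bs nb by (intro exI[of _ "bs @ [b]"]) auto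
  qed
  from this[of n] obtain bs where bs: "length bs = n" "distinct bs" "lin_indpt (set bs)"
    "\<And>j. j \<le> n \<Longrightarrow> set (take j bs) \<subseteq> F j" by auto
  have c: "set bs \<subseteq> carrier_vec n" using bs(1) bs(4)[of n] carr[of n] by auto
  define M where "M = mat_of_cols n bs"
  have M: "M \<in> carrier_mat n n" using mat_of_cols_carrier(1)[of n bs] by (simp add: M_def bs)
  have cols: "cols M = bs" using c by (simp add: M_def)
  have "rank M = n" using lin_indpt_full_rank[OF M] bs cols by simp
  then have "det M \<noteq> 0" using det_rank_iff[OF M] by simp
  from det_non_zero_imp_unit[OF M this, of n]
  obtain N where "N \<in> carrier_mat n n" "N * M = 1\<^sub>m n" "M * N = 1\<^sub>m n"
    by (auto simp: Units_def ring_mat_def)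
  with M have inv: "invertible_mat M"
    unfolding invertible_mat_def inverts_mat_def by auto
  have "F k = col_space (submatrix M UNIV {..<k})" if k: "k \<le> n" for k
  proof -
    have "submatrix M UNIV {..<k} = mat_of_cols n (take k bs)"
    proof (rule eq_matI)
      have k': "{j. j < n \<and> j \<in> {..<k}} = {..<k}" using k by auto
      show dr: "dim_row (submatrix M UNIV {..<k}) = dim_row (mat_of_cols n (take k bs))"
        "dim_col (submatrix M UNIV {..<k}) = dim_col (mat_of_cols n (take k bs))"
        using M bs k k' by (auto simp: dim_submatrix)
      fix i j assume "i < dim_row (mat_of_cols n (take k bs))" "j < dim_col (mat_of_cols n (take k bs))"
      then have ij: "i < n" "j < k" using bs k by auto
      have "{a \<in> {..<k}. a < j} = {..<j}" using ij by auto
      then have "submatrix M UNIV {..<k} $$ (i, j) = M $$ (i, j)"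
        using submatrix_index_card[of i M j UNIV "{..<k}"] M ij k by simp
      then show "submatrix M UNIV {..<k} $$ (i, j) = mat_of_cols n (take k bs) $$ (i, j)"
        using ij k bs by (simp add: M_def mat_of_cols_def)
    qed
    moreover have "set (take k bs) \<subseteq> carrier_vec n" using c set_take_subset[of k bs] by (rule order_trans[rotated])
    ultimately have "col_space (submatrix M UNIV {..<k}) = span (set (take k bs))"
      by (simp add: col_space_def)
    also have "\<dots> = F k"
    proof (rule basis[OF k])
      show "lin_indpt (set (take k bs))"
        using subset_li_is_li[OF bs(3) set_take_subset] .
      show "set (take k bs) \<subseteq> F k" using bs(4)[OF k] by simp
      show "card (set (take k bs)) = k" using bs(1,2) k by (simp add: distinct_card)
    qed simp
    finally show ?thesis by simp
  qed
  with M inv show ?thesis unfolding represents_def by blast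
qed

text \<open>
  The quantities below are read off from a chosen representing matrix. Ranks do not depend on the
  choice. A flag minor, and hence a multi-Pluecker coordinate, is only defined up to a nonzero
  scalar (which depends on the choice but not on the rows), so that only its vanishing is
  meaningful.
\<close>

definition flag_matrix :: "nat \<Rightarrow> (nat \<Rightarrow> complex vec set) \<Rightarrow> complex mat" where
  "flag_matrix n F = (SOME M. represents n M F)"

definition flag_rank :: "nat \<Rightarrow> nat set \<Rightarrow> (nat \<Rightarrow> complex vec set) \<Rightarrow> nat \<Rightarrow> nat" where
  "flag_rank n S F k =
     (let A = submatrix (flag_matrix n F) {i. Suc i \<in> S} {..<k} in vec_space.rank (dim_row A) A)"

text \<open>The rows of the minor are taken in the order of the list.\<close>

definition flag_minor :: "nat \<Rightarrow> nat list \<Rightarrow> (nat \<Rightarrow> complex vec set) \<Rightarrow> complex" where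
  "flag_minor n is F =
     det (mat (length is) (length is) (\<lambda>(r, c). flag_matrix n F $$ (is ! r - 1, c)))"

definition multi_pluecker :: "nat \<Rightarrow> (nat \<Rightarrow> nat) \<Rightarrow> (nat \<Rightarrow> complex vec set) \<Rightarrow> complex" where
  "multi_pluecker n w F = (\<Prod>k = 1..n. flag_minor n (map w [1..<Suc k]) F)"

section \<open>Cyclically shifted orders\<close>

definition cyc_interval :: "nat \<Rightarrow> nat \<Rightarrow> nat \<Rightarrow> nat set" where
  "cyc_interval n a b = (if a \<le> b then {a..<b} else {a..n} \<union> {1..<b})"

text \<open>
  \<open>(i + n - r) mod n\<close> is the position of \<open>i\<close>, counted from \<open>0\<close>, in \<open>r, r + 1, \<dots>, n, 1, \<dots>, r - 1\<close>.
\<close>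

definition cyc_less :: "nat \<Rightarrow> nat \<Rightarrow> nat \<Rightarrow> nat \<Rightarrow> bool" where
  "cyc_less n r i j \<longleftrightarrow> (i + n - r) mod n < (j + n - r) mod n"

definition cyc_subset_le :: "nat \<Rightarrow> nat \<Rightarrow> nat set \<Rightarrow> nat set \<Rightarrow> bool" where
  "cyc_subset_le n r A B \<longleftrightarrow> (\<exists>as bs.
     set as = A \<and> sorted_wrt (cyc_less n r) as \<and>
     set bs = B \<and> sorted_wrt (cyc_less n r) bs \<and>
     list_all2 (\<lambda>i j. cyc_less n r i j \<or> i = j) as bs)"

text \<open>
  The sequence \<open>a \<in> [n]\<^sup>n\<close> is a function of which only the values at \<open>1, \<dots>, n\<close> matter.
\<close>

definition tilted_le :: "nat \<Rightarrow> (nat \<Rightarrow> nat) \<Rightarrow> (nat \<Rightarrow> nat) \<Rightarrow> (nat \<Rightarrow> nat) \<Rightarrow> bool" where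
  "tilted_le n a u v \<longleftrightarrow> (\<forall>k\<in>{1..n}. cyc_subset_le n (a k) (u ` {1..k}) (v ` {1..k}))"

lemma cyc_subset_le_by_counting:
  assumes A: "A \<subseteq> {1..n}" and B: "B \<subseteq> {1..n}" and card_eq: "card A = card B"
    and r: "r \<in> {1..n}"
    and count: "\<And>t. card {i \<in> B. (i + n - r) mod n \<le> t} \<le> card {i \<in> A. (i + n - r) mod n \<le> t}"
  shows "cyc_subset_le n r A B"
proof -
  define p where "p i = (i + n - r) mod n" for i
  have less: "cyc_less n r i j \<longleftrightarrow> p i < p j" for i j
    by (simp add: cyc_less_def p_def)
  have p_eq: "p i = (if r \<le> i then i - r else i + n - r)" if "i \<in> {1..n}" for i
    using that r by (auto simp: p_def mod_if)
  have inj: "inj_on p {1..n}"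
    using r by (auto simp: inj_on_def p_eq split: if_splits)
  have lists: "\<exists>xs. set xs = X \<and> length xs = card X \<and> sorted_wrt (cyc_less n r) xs"
    if "X \<subseteq> {1..n}" for X
  proof -
    define xs where "xs = sort_key p (sorted_list_of_set X)"
    have fin: "finite X" using that finite_subset by blast
    have s: "set xs = X" and d: "distinct xs" by (simp_all add: xs_def fin)
    have "sorted (map p xs)" by (simp add: xs_def)
    moreover have "distinct (map p xs)"
      using d s that inj by (auto simp: distinct_map intro: inj_on_subset)
    ultimately have "sorted_wrt (<) (map p xs)" by (simp add: strict_sorted_iff)
    then have "sorted_wrt (cyc_less n r) xs"
      by (simp add: sorted_wrt_map sorted_wrt_iff_nth_less less)
    with s show ?thesis using d distinct_card by metis
  qed
  obtain as where as: "set as = A" "length as = card A" "sorted_wrt (cyc_less n r) as"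
    using lists[OF A] by blast
  obtain bs where bs: "set bs = B" "length bs = card B" "sorted_wrt (cyc_less n r) bs"
    using lists[OF B] by blast
  have distinct: "distinct as" "distinct bs"
    using as bs by (metis card_distinct)+
  have "list_all2 (\<lambda>i j. cyc_less n r i j \<or> i = j) as bs"
  proof (rule list_all2_all_nthI)
    show "length as = length bs" by (simp add: as bs card_eq)
  next
    fix j assume j: "j < length as"
    have jb: "j < length bs" using j as bs card_eq by simp
    have "p (as ! j) \<le> p (bs ! j)"
    proof (rule ccontr)
      assume "\<not> ?thesis"
      then have gt: "p (bs ! j) < p (as ! j)" by simp
      let ?t = "p (bs ! j)"
      have "(!) bs ` {..j} \<subseteq> {i \<in> B. p i \<le> ?t}"
      proof clarify
        fix m assume "m \<le> j"
        moreover have "p (bs ! m) \<le> ?t"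
          using \<open>m \<le> j\<close> bs(3) jb by (cases "m = j") (auto simp: sorted_wrt_iff_nth_less less intro: less_imp_le)
        ultimately show "bs ! m \<in> B \<and> p (bs ! m) \<le> ?t" using jb bs by auto
      qed
      moreover have "card ((!) bs ` {..j}) = Suc j"
        using distinct jb by (subst card_image) (auto simp: inj_on_def nth_eq_iff_index_eq)
      moreover have "finite B" using B finite_subset by blast
      ultimately have 1: "Suc j \<le> card {i \<in> B. p i \<le> ?t}"
        using card_mono[of "{i \<in> B. p i \<le> ?t}" "(!) bs ` {..j}"] by simp
      have "{i \<in> A. p i \<le> ?t} \<subseteq> (!) as ` {..<j}"
      proof clarify
        fix i assume "i \<in> A" "p i \<le> ?t"
        then obtain m where m: "m < length as" "as ! m = i" using as by (metis in_set_conv_nth)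
        have "m < j"
        proof (rule ccontr)
          assume "\<not> m < j"
          then have "p (as ! j) \<le> p i"
            using m as(3) by (cases "m = j") (auto simp: sorted_wrt_iff_nth_less less intro: less_imp_le)
          then show False using gt \<open>p i \<le> ?t\<close> by simp
        qed
        then show "i \<in> (!) as ` {..<j}" using m by auto
      qed
      then have "card {i \<in> A. p i \<le> ?t} \<le> j"
        using surj_card_le[of "{..<j}" "{i \<in> A. p i \<le> ?t}" "(!) as"] by simp
      with 1 count[of ?t] show False by (simp add: p_def)
    qed
    moreover have "as ! j \<in> {1..n}" "bs ! j \<in> {1..n}"
      using j jb as bs A B nth_mem by blast+
    ultimately show "cyc_less n r (as ! j) (bs ! j) \<or> as ! j = bs ! j"
      using inj_onD[OF inj, of "as ! j" "bs ! j"] unfolding less by linarith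
  qed
  with as bs show ?thesis unfolding cyc_subset_le_def by blast
qed

lemma cyc_subset_le_ex:
  assumes A: "A \<subseteq> {1..n}" and B: "B \<subseteq> {1..n}" and card_eq: "card A = card B" and n: "0 < n"
  shows "\<exists>r\<in>{1..n}. cyc_subset_le n r A B"
proof -
  define c where "c X i = int (card (X \<inter> {1..i}))" for X and i :: nat
  define g where "g i = c A i - c B i" for i
  obtain m where m: "m < n" "\<And>i. i < n \<Longrightarrow> g m \<le> g i"
  proof -
    have "finite (g ` {..<n})" "g ` {..<n} \<noteq> {}" using n by auto
    from Min_in[OF this] obtain m where "m < n" "g m = Min (g ` {..<n})" by auto
    then show ?thesis using that by (simp add: \<open>finite (g ` {..<n})\<close>)
  qed
  have full: "c A n = c B n" using A B card_eq by (simp add: c_def Int_absorb2)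
  have g0: "g 0 = 0" and gn: "g n = 0" using full by (auto simp: g_def c_def)
  then have gm: "g m \<le> g i" if "i \<le> n" for i
    using m(2)[of i] m(2)[of 0] n that by (cases "i = n") auto
  have cnt: "int (card {i \<in> X. (i + n - Suc m) mod n \<le> t}) =
      (if t \<ge> n then c X n
       else if Suc m + t \<le> n then c X (Suc m + t) - c X m
       else c X n - c X m + c X (Suc m + t - n))" if X: "X \<subseteq> {1..n}" for X t
  proof -
    have p: "(i + n - Suc m) mod n = (if Suc m \<le> i then i - Suc m else i + n - Suc m)"
      if "i \<in> X" for i
    proof (cases "Suc m \<le> i")
      case True
      then have "i + n - Suc m = (i - Suc m) + n" by simp
      moreover have "i - Suc m < n" using that X n by (auto dest!: subsetD)
      ultimately show ?thesis using True by (metis mod_add_self2 mod_less)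
    next
      case False
      then have "i + n - Suc m < n" using m by simp
      then show ?thesis using False by simp
    qed
    have diff: "int (card (X \<inter> {Suc x..y})) = c X y - c X x" if "x \<le> y" for x y
    proof -
      have "X \<inter> {1..y} = (X \<inter> {1..x}) \<union> (X \<inter> {Suc x..y})" using that by auto
      moreover have "(X \<inter> {1..x}) \<inter> (X \<inter> {Suc x..y}) = {}" by (rule equals0I) auto
      ultimately have "card (X \<inter> {1..y}) = card (X \<inter> {1..x}) + card (X \<inter> {Suc x..y})"
        by (simp add: card_Un_disjoint)
      then show ?thesis by (simp add: c_def)
    qed
    consider "t \<ge> n" | "t < n" "Suc m + t \<le> n" | "t < n" "Suc m + t > n" by linarith
    then show ?thesis
    proof cases
      case 1
      then have "{i \<in> X. (i + n - Suc m) mod n \<le> t} = X \<inter> {1..n}"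
        using X n by (auto intro: less_imp_le[OF less_le_trans[OF mod_less_divisor]])
      then show ?thesis using 1 by (simp add: c_def)
    next
      case 2
      then have "{i \<in> X. (i + n - Suc m) mod n \<le> t} = X \<inter> {Suc m..Suc m + t}"
        using X m by (auto simp: p split: if_splits)
      then show ?thesis using 2 diff[of m "Suc m + t"] by simp
    next
      case 3
      then have "{i \<in> X. (i + n - Suc m) mod n \<le> t} =
          (X \<inter> {Suc m..n}) \<union> (X \<inter> {1..Suc m + t - n})"
        using X m by (auto simp: p split: if_splits)
      moreover have "(X \<inter> {Suc m..n}) \<inter> (X \<inter> {1..Suc m + t - n}) = {}" using 3 by auto
      ultimately have "card {i \<in> X. (i + n - Suc m) mod n \<le> t} =
          card (X \<inter> {Suc m..n}) + card (X \<inter> {1..Suc m + t - n})"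
        by (simp add: card_Un_disjoint)
      then show ?thesis using 3 m diff[of m n] by (simp add: c_def)
    qed
  qed
  have "cyc_subset_le n (Suc m) A B"
  proof (rule cyc_subset_le_by_counting[OF A B card_eq])
    show "Suc m \<in> {1..n}" using m by simp
  next
    fix t
    have "g m \<le> g (Suc m + t - n)" if "t < n" using that m(1) by (intro gm) simp
    then have "int (card {i \<in> B. (i + n - Suc m) mod n \<le> t})
            \<le> int (card {i \<in> A. (i + n - Suc m) mod n \<le> t})"
      unfolding cnt[OF A] cnt[OF B]
      using full gn gm[of "Suc m + t"]
      by (auto simp: g_def)
    then show "card {i \<in> B. (i + n - Suc m) mod n \<le> t}
        \<le> card {i \<in> A. (i + n - Suc m) mod n \<le> t}" by simp
  qed
  with m show ?thesis by (intro bexI[of _ "Suc m"]) auto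
qed

lemma tilted_le_ex:
  assumes u: "u permutes {1..n}" and v: "v permutes {1..n}"
  shows "\<exists>a. (\<forall>k\<in>{1..n}. a k \<in> {1..n}) \<and> tilted_le n a u v"
proof -
  have "\<exists>r\<in>{1..n}. cyc_subset_le n r (u ` {1..k}) (v ` {1..k})" if k: "k \<in> {1..n}" for k
  proof (rule cyc_subset_le_ex)
    show "u ` {1..k} \<subseteq> {1..n}" "v ` {1..k} \<subseteq> {1..n}"
      using k permutes_image[OF u] permutes_image[OF v] by fastforce+
    show "card (u ` {1..k}) = card (v ` {1..k})"
      by (simp add: card_image permutes_inj_on[OF u] permutes_inj_on[OF v])
  qed (use k in auto)
  then have "\<forall>k\<in>{1..n}. \<exists>r. r \<in> {1..n} \<and> cyc_subset_le n r (u ` {1..k}) (v ` {1..k})" by blast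
  from bchoice[OF this] show ?thesis unfolding tilted_le_def by blast
qed

section \<open>Tilted Richardson varieties\<close>

text \<open>
  The definitions carry the sequence \<open>a\<close>; they are meant for \<open>a \<in> [n]\<^sup>n\<close> with \<open>tilted_le n a u v\<close>,
  for which the resulting set does not depend on \<open>a\<close>.
\<close>

definition tilted_richardson ::
  "nat \<Rightarrow> (nat \<Rightarrow> nat) \<Rightarrow> (nat \<Rightarrow> nat) \<Rightarrow> (nat \<Rightarrow> nat) \<Rightarrow> (nat \<Rightarrow> complex vec set) set" where
  "tilted_richardson n a u v = {F \<in> complete_flags n. \<forall>i\<in>{1..n}. \<forall>k\<in>{1..n}.
     flag_rank n (cyc_interval n (a k) i) F k \<le> card (u ` {1..k} \<inter> cyc_interval n (a k) i) \<and>
     flag_rank n (cyc_interval n i (a k)) F k \<le> card (v ` {1..k} \<inter> cyc_interval n i (a k))}"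

definition open_tilted_richardson ::
  "nat \<Rightarrow> (nat \<Rightarrow> nat) \<Rightarrow> (nat \<Rightarrow> nat) \<Rightarrow> (nat \<Rightarrow> nat) \<Rightarrow> (nat \<Rightarrow> complex vec set) set" where
  "open_tilted_richardson n a u v = {F \<in> complete_flags n. \<forall>i\<in>{1..n}. \<forall>k\<in>{1..n}.
     flag_rank n (cyc_interval n (a k) i) F k = card (u ` {1..k} \<inter> cyc_interval n (a k) i) \<and>
     flag_rank n (cyc_interval n i (a k)) F k = card (v ` {1..k} \<inter> cyc_interval n i (a k))}"

section \<open>The quantum Bruhat graph and tilted Bruhat intervals\<close>

definition inversions :: "nat \<Rightarrow> (nat \<Rightarrow> nat) \<Rightarrow> nat" where
  "inversions n w = card {(i, j). 1 \<le> i \<and> i < j \<and> j \<le> n \<and> w j < w i}"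

definition quantum_bruhat_graph :: "nat \<Rightarrow> ((nat \<Rightarrow> nat) \<times> (nat \<Rightarrow> nat)) set" where
  "quantum_bruhat_graph n = {(w, w \<circ> transpose i j) | w i j.
     w permutes {1..n} \<and> 1 \<le> i \<and> i < j \<and> j \<le> n \<and>
     (int (inversions n (w \<circ> transpose i j)) = int (inversions n w) + 1 \<or>
      int (inversions n (w \<circ> transpose i j)) = int (inversions n w) + 1 - 2 * int (j - i))}"

text \<open>
  A path exists between any two permutations, since \<open>w \<rightarrow> w \<circ> transpose i (i + 1)\<close> is always an edge.
\<close>

definition qb_dist :: "nat \<Rightarrow> (nat \<Rightarrow> nat) \<Rightarrow> (nat \<Rightarrow> nat) \<Rightarrow> nat" where
  "qb_dist n x y = (LEAST m. (x, y) \<in> quantum_bruhat_graph n ^^ m)"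

definition tilted_interval :: "nat \<Rightarrow> (nat \<Rightarrow> nat) \<Rightarrow> (nat \<Rightarrow> nat) \<Rightarrow> (nat \<Rightarrow> nat) set" where
  "tilted_interval n u v =
     {w. w permutes {1..n} \<and> qb_dist n u w + qb_dist n w v = qb_dist n u v}"

end

theory Submission
  imports Defs "HOL-Library.Function_Algebras"
begin

text \<open>
  For sets \<open>A\<close>, \<open>B\<close> of equal size let \<open>d(A, B)\<close> be the maximum over \<open>m\<close> of
  \<open>|B \<inter> [m]| - |A \<inter> [m]|\<close>; then \<open>A \<le>\<^sub>r B\<close> iff the maximum is attained at \<open>m = r - 1\<close>. The distance in the
  quantum Bruhat graph is \<open>\<ell>(v) - \<ell>(u) + 2 \<Sum>\<^sub>k d(u[k], v[k])\<close>: the right-hand side is subadditive and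
  equals 1 on edges, and for \<open>u \<noteq> v\<close> there is an edge \<open>u \<rightarrow> u t\<^sub>i\<^sub>j\<close> that decreases it by 1, where \<open>i\<close> is
  the first position at which \<open>u\<close> and \<open>v\<close> differ and \<open>j > i\<close> is the first position with \<open>u\<^sub>j\<close> in the
  cyclic interval from \<open>u\<^sub>i\<close> (excluded) to \<open>v\<^sub>i\<close> (included). Hence \<open>w \<in> [u, v]\<close> iff every triangle
  inequality for \<open>d\<close> is an equality at \<open>u[k], w[k], v[k]\<close>, that is, iff \<open>u \<le>\<^sub>a w \<le>\<^sub>a v\<close>.

  On the other side, the rank of a set \<open>S\<close> of rows is the maximum of \<open>|I \<inter> S|\<close> over the bases \<open>I\<close> of
  the row matroid of \<open>F\<^sub>k\<close>, so the rank conditions say that \<open>u[k] \<le>\<^sub>a I \<le>\<^sub>a v[k]\<close> for all these bases.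
  As every basis of \<open>F\<^sub>k\<close> is \<open>w[k]\<close> for some \<open>w\<close> all of whose prefixes are bases, the two descriptions
  agree. Equality of ranks along all initial (final) segments makes \<open>u[k]\<close> (\<open>v[k]\<close>) a greedy basis.
\<close>

section \<open>Excess of one set over another\<close>

text \<open>The height after \<open>m\<close> steps of the lattice path that goes up at the elements
  of \<open>B - A\<close> and down at those of \<open>A - B\<close>.\<close>

definition excess :: "nat set \<Rightarrow> nat set \<Rightarrow> nat \<Rightarrow> int" where
  "excess A B m = int (card (B \<inter> {1..m})) - int (card (A \<inter> {1..m}))"

text \<open>The quantity \<open>d(A, B)\<close>, the highest point of the path. The starting point
  \<open>m = 0\<close> counts, so the value is never negative.\<close>

definition qdeg :: "nat \<Rightarrow> nat set \<Rightarrow> nat set \<Rightarrow> int" where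
  "qdeg n A B = Max (excess A B ` {..n})"

lemma excess_0 [simp]: "excess A B 0 = 0"
  by (simp add: excess_def)

lemma excess_full: "A \<subseteq> {1..n} \<Longrightarrow> B \<subseteq> {1..n} \<Longrightarrow> card A = card B \<Longrightarrow> excess A B n = 0"
  by (simp add: excess_def Int_absorb2)

lemma excess_add: "excess A C m = excess A B m + excess B C m"
  by (simp add: excess_def)

lemma excess_le_qdeg: "m \<le> n \<Longrightarrow> excess A B m \<le> qdeg n A B"
  by (simp add: qdeg_def)

lemma qdeg_leI: "(\<And>m. m \<le> n \<Longrightarrow> excess A B m \<le> d) \<Longrightarrow> qdeg n A B \<le> d"
  by (auto simp: qdeg_def)

lemma qdeg_attained: obtains m where "m \<le> n" "excess A B m = qdeg n A B"
proof -
  have "qdeg n A B \<in> excess A B ` {..n}"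
    unfolding qdeg_def by (rule Max_in) auto
  then show ?thesis using that by auto
qed

lemma qdeg_eqI:
  "(\<And>m. m \<le> n \<Longrightarrow> excess A B m \<le> d) \<Longrightarrow> m \<le> n \<Longrightarrow> excess A B m = d \<Longrightarrow> qdeg n A B = d"
  using excess_le_qdeg[of m n A B] qdeg_leI[of n A B d] by auto

lemma qdeg_nonneg: "0 \<le> qdeg n A B"
  using excess_le_qdeg[of 0 n A B] by simp

lemma qdeg_self [simp]: "qdeg n A A = 0"
  by (rule qdeg_eqI[of _ _ _ _ 0]) (auto simp: excess_def)

lemma qdeg_triangle: "qdeg n A C \<le> qdeg n A B + qdeg n B C"
proof (rule qdeg_leI)
  fix m assume "m \<le> n"
  then show "excess A C m \<le> qdeg n A B + qdeg n B C"
    using excess_le_qdeg[of m n A B] excess_le_qdeg[of m n B C] excess_add[of A C m B] by linarith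
qed

text \<open>At an index \<open>m\<close> where the outer excess is maximal, the two inner excesses
  add up to \<open>qdeg n A C\<close>, and each is bounded by its own maximum. Equality in the
  triangle inequality thus becomes a condition at this single index.\<close>

lemma qdeg_additive_iff:
  assumes "m \<le> n" "excess A C m = qdeg n A C"
  shows "qdeg n A B + qdeg n B C = qdeg n A C
    \<longleftrightarrow> excess A B m = qdeg n A B \<and> excess B C m = qdeg n B C"
  using assms excess_le_qdeg[of m n A B] excess_le_qdeg[of m n B C] excess_add[of A C m B] by linarith

section \<open>Change of the excess along an interval and under an exchange of one element\<close>

lemma excess_split:
  assumes "p \<le> q"
  shows "excess A B q = excess A B p + int (card (B \<inter> {p<..q})) - int (card (A \<inter> {p<..q}))"
proof -
  have "int (card (X \<inter> {1..q})) = int (card (X \<inter> {1..p})) + int (card (X \<inter> {p<..q}))" for X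
  proof -
    have "X \<inter> {1..q} = (X \<inter> {1..p}) \<union> (X \<inter> {p<..q})" using assms by auto
    moreover have "(X \<inter> {1..p}) \<inter> (X \<inter> {p<..q}) = {}" by auto
    ultimately show ?thesis by (simp add: card_Un_disjoint)
  qed
  then show ?thesis by (simp add: excess_def)
qed

lemma excess_mono:
  assumes "p \<le> q" "A \<inter> {p<..q} \<subseteq> B"
  shows "excess A B p \<le> excess A B q"
proof -
  have "card (A \<inter> {p<..q}) \<le> card (B \<inter> {p<..q})" by (rule card_mono) (use assms in auto)
  then show ?thesis using excess_split[OF assms(1), of A B] by linarith
qed

lemma excess_strict_mono:
  assumes "p < q" "A \<inter> {p<..q} \<subseteq> B" "q \<in> B - A"
  shows "excess A B p + 1 \<le> excess A B q"
proof -
  have "card (A \<inter> {p<..q}) < card (B \<inter> {p<..q})"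
    by (rule psubset_card_mono) (use assms in auto)
  then show ?thesis using excess_split[OF less_imp_le[OF assms(1)], of A B] by linarith
qed

lemma excess_swap_left:
  assumes "finite A" "x \<in> A" "y \<notin> A" "1 \<le> x" "1 \<le> y"
  shows "excess (insert y (A - {x})) B m = excess A B m - of_bool (y \<le> m) + of_bool (x \<le> m)"
proof -
  have "int (card (insert y (A - {x}) \<inter> {1..m}))
      = int (card (A \<inter> {1..m})) + of_bool (y \<le> m) - of_bool (x \<le> m)"
  proof -
    have fin: "finite (A \<inter> {1..m})" by simp
    have e: "insert y (A - {x}) \<inter> {1..m} =
        (if y \<le> m then insert y ((A \<inter> {1..m}) - (if x \<le> m then {x} else {}))
         else (A \<inter> {1..m}) - (if x \<le> m then {x} else {}))"
      using assms by auto
    have c: "int (card ((A \<inter> {1..m}) - (if x \<le> m then {x} else {})))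
        = int (card (A \<inter> {1..m})) - of_bool (x \<le> m)"
    proof (cases "x \<le> m")
      case True
      then have "x \<in> A \<inter> {1..m}" using assms by auto
      then have "card (A \<inter> {1..m}) = Suc (card (A \<inter> {1..m} - {x}))"
        using card.remove[OF fin] by blast
      then show ?thesis using True by simp
    qed simp
    have "y \<notin> (A \<inter> {1..m}) - (if x \<le> m then {x} else {})" using assms by auto
    then show ?thesis unfolding e using c fin by (auto simp: assms)
  qed
  then show ?thesis by (simp add: excess_def)
qed

text \<open>The excess of the exchanged set over \<open>A\<close> is the indicator of
  \<open>y \<le> m\<close> minus that of \<open>x \<le> m\<close>. It is positive exactly for
  \<open>y \<le> m < x\<close>.\<close>

lemma qdeg_swap_right:
  assumes "A \<subseteq> {1..n}" "x \<in> A" "y \<notin> A" "y \<in> {1..n}"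
  shows "qdeg n A (insert y (A - {x})) = of_bool (y < x)"
proof -
  have fin: "finite A" using assms(1) finite_subset by blast
  have x: "1 \<le> x" "x \<le> n" using assms by auto
  have y: "1 \<le> y" "y \<le> n" using assms by auto
  have e: "excess A (insert y (A - {x})) m = of_bool (y \<le> m) - of_bool (x \<le> m)" for m
    using excess_swap_left[OF fin assms(2,3) x(1) y(1), of A m]
      excess_add[of A A m "insert y (A - {x})"] by (simp add: excess_def)
  show ?thesis
  proof (cases "y < x")
    case True
    show ?thesis by (rule qdeg_eqI[of _ _ _ _ y]) (use True y in \<open>auto simp: e\<close>)
  next
    case False
    show ?thesis by (rule qdeg_eqI[of _ _ _ _ 0]) (use False in \<open>auto simp: e\<close>)
  qed
qed

text \<open>The cyclic interval \<open>(x, z]\<close>, meant for \<open>x \<noteq> z\<close>.\<close>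

definition arc :: "nat \<Rightarrow> nat \<Rightarrow> nat \<Rightarrow> nat set" where
  "arc n x z = (if x < z then {x<..z} else {x<..n} \<union> {1..z})"

text \<open>Up to the constant \<open>of_bool (y < x)\<close>, the exchange raises the excess by one
  on the cyclic interval from \<open>x\<close> (included) to \<open>y\<close> (excluded) and leaves
  it alone elsewhere. On the way from a point of that interval to \<open>z\<close> the path never
  goes down, since every element of \<open>A\<close> it meets lies in \<open>B\<close>, and it goes
  up at \<open>z\<close>. So the old maximum is not attained on that interval.\<close>

lemma qdeg_step:
  assumes A: "A \<subseteq> {1..n}" and B: "B \<subseteq> {1..n}" and card: "card A = card B"
    and x: "x \<in> A" and y: "y \<notin> A" "y \<in> arc n x z" and z: "z \<in> B - A"
    and arc: "arc n x z \<inter> A \<subseteq> B"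
  shows "qdeg n A (insert y (A - {x})) + qdeg n (insert y (A - {x})) B = qdeg n A B"
proof -
  have fin: "finite A" using A finite_subset by blast
  have bounds: "1 \<le> x" "x \<le> n" "1 \<le> z" "z \<le> n" "x \<noteq> z"
    using A B x z by auto
  then have yn: "1 \<le> y" "y \<le> n" using y by (auto simp: arc_def split: if_splits)
  have en: "excess A B n = 0" by (rule excess_full[OF A B card])
  have arcD: "m \<in> B" if "m \<in> arc n x z" "m \<in> A" for m using arc that by blast
  have rise: "excess A B m + 1 \<le> excess A B z"
    if hm: "m < n \<and> (if x < y then x \<le> m \<and> m < y else x \<le> m \<or> m < y) \<or> m = n \<and> y < x" for m
  proof -
    have xy: "x \<noteq> y" using x y by auto
    \<comment> \<open>The way from \<open>m\<close> to \<open>z\<close> does not wrap around, or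
      passes \<open>n\<close>, or starts after the wrap. In the second case it continues from 0 at
      the same height, as the excess vanishes at both 0 and \<open>n\<close>.\<close>
    consider "x < z" "x \<le> m" "m < z" | "z < x" "x \<le> m" "m \<le> n" | "z < x" "m < z"
      using hm y yn xy bounds by (auto simp: arc_def split: if_splits)
    then show ?thesis
    proof cases
      case 1
      then have "A \<inter> {m<..z} \<subseteq> B" using arcD by (auto simp: arc_def)
      then show ?thesis using excess_strict_mono[of m z A B] 1 z by blast
    next
      case 2
      have "A \<inter> {m<..n} \<subseteq> B" using arcD 2 by (auto simp: arc_def)
      then have "excess A B m \<le> excess A B n" using excess_mono 2 by blast
      moreover have "A \<inter> {0<..z} \<subseteq> B" using arcD 2 by (auto simp: arc_def)
      then have "excess A B 0 + 1 \<le> excess A B z"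
        using excess_strict_mono[of 0 z A B] z bounds by simp
      ultimately show ?thesis using en by simp
    next
      case 3
      then have "A \<inter> {m<..z} \<subseteq> B" using arcD by (auto simp: arc_def)
      then show ?thesis using excess_strict_mono[of m z A B] 3 z by blast
    qed
  qed
  have ez: "excess A B z \<le> qdeg n A B" using bounds by (intro excess_le_qdeg)
  note e = excess_swap_left[OF fin x y(1) bounds(1) yn(1), of B]
  obtain m0 where m0: "m0 \<le> n" "excess A B m0 = qdeg n A B" by (rule qdeg_attained)
  have d: "qdeg n A (insert y (A - {x})) = of_bool (y < x)"
    using qdeg_swap_right[OF A x y(1)] yn by simp
  have "x \<noteq> y" using x y by auto
  let ?I = "\<lambda>m. if x < y then x \<le> m \<and> m < y else x \<le> m \<or> m < y"
  have strict: "excess A B m + 1 \<le> qdeg n A B" if "m \<le> n" "?I m" for m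
    using rise[of m] that ez yn bounds \<open>x \<noteq> y\<close>
    by (cases "m = n"; cases x y rule: linorder_cases) auto
  have out: "\<not> ?I m0" using strict[OF m0(1)] m0(2) by linarith
  \<comment> \<open>Outside \<open>?I\<close> the excess changes by exactly
    \<open>- of_bool (y < x)\<close>. Inside it changes by one more, which the slack in
    \<open>strict\<close> absorbs.\<close>
  have "qdeg n (insert y (A - {x})) B = qdeg n A B - of_bool (y < x)"
  proof (rule qdeg_eqI[OF _ m0(1)])
    fix m assume m: "m \<le> n"
    show "excess (insert y (A - {x})) B m \<le> qdeg n A B - of_bool (y < x)"
    proof (cases "?I m")
      case True
      then show ?thesis unfolding e using strict[OF m True] by (auto split: if_splits)
    next
      case False
      then show ?thesis unfolding e using excess_le_qdeg[OF m, of A B] \<open>x \<noteq> y\<close>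
        by (auto split: if_splits)
    qed
  next
    show "excess (insert y (A - {x})) B m0 = qdeg n A B - of_bool (y < x)"
      unfolding e using out m0 \<open>x \<noteq> y\<close> by (auto split: if_splits)
  qed
  with d show ?thesis by simp
qed

section \<open>Distance in the quantum Bruhat graph\<close>

text \<open>Only pairs made of \<open>i\<close> or \<open>j\<close> and a position between them, and
  the pair \<open>i, j\<close> itself, change status. An intermediate position whose value lies
  between \<open>w i\<close> and \<open>w j\<close> gains two inversions. With any other value it
  gains one and loses one.\<close>

lemma inversions_swap:
  assumes w: "inj w" and ij: "1 \<le> i" "i < j" "j \<le> n" and less: "w i < w j"
  shows "inversions n (w \<circ> transpose i j)
    = inversions n w + 1 + 2 * card {k \<in> {i<..<j}. w i < w k \<and> w k < w j}"
proof -
  define s where "s = transpose i j"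
  define P where "P = {(p, q). p \<in> {1..n} \<and> q \<in> {1..n} \<and> w q < w p}"
  define X where "X = {(p, q) \<in> P. p < q}"
  \<comment> \<open>The inversions of \<open>w \<circ> s\<close>, relabelled by \<open>s\<close>, so
    that they can be compared with \<open>X\<close> inside the same set \<open>P\<close>.\<close>
  define Y where "Y = {(p, q) \<in> P. s p < s q}"
  have "P \<subseteq> {1..n} \<times> {1..n}" by (auto simp: P_def)
  then have fin: "finite P" using finite_subset by blast
  then have finX: "finite X" and finY: "finite Y"
    by (auto simp: X_def Y_def intro: finite_subset[OF _ fin])
  have s: "s i = j" "s j = i" "\<And>k. k \<noteq> i \<Longrightarrow> k \<noteq> j \<Longrightarrow> s k = k"
    by (auto simp: s_def)
  have ss: "s (s k) = k" for k by (simp add: s_def)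
  have sN: "s k \<in> {1..n} \<longleftrightarrow> k \<in> {1..n}" for k
    using ij s by (cases "k = i"; cases "k = j") auto
  have X: "inversions n w = card X"
    unfolding inversions_def X_def P_def by (rule arg_cong[of _ _ card]) auto
  have Y: "inversions n (w \<circ> s) = card Y"
  proof -
    have "{(p, q). 1 \<le> p \<and> p < q \<and> q \<le> n \<and> (w \<circ> s) q < (w \<circ> s) p} = map_prod s s ` Y"
    proof (intro subset_antisym subsetI)
      fix z assume "z \<in> {(p, q). 1 \<le> p \<and> p < q \<and> q \<le> n \<and> (w \<circ> s) q < (w \<circ> s) p}"
      then obtain p q where z: "z = (p, q)" "1 \<le> p" "p < q" "q \<le> n" "w (s q) < w (s p)" by auto
      then have "(s p, s q) \<in> Y" using sN[of p] sN[of q] by (auto simp: Y_def P_def ss)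
      then show "z \<in> map_prod s s ` Y" using z ss by (intro image_eqI[of _ _ "(s p, s q)"]) auto
    next
      fix z assume "z \<in> map_prod s s ` Y"
      then obtain p q where "z = (s p, s q)" "(p, q) \<in> Y" by auto
      then show "z \<in> {(p, q). 1 \<le> p \<and> p < q \<and> q \<le> n \<and> (w \<circ> s) q < (w \<circ> s) p}"
        using sN[of p] sN[of q] by (auto simp: Y_def P_def ss)
    qed
    moreover have "inj_on (map_prod s s) Y"
      by (rule inj_on_inverseI[of _ "map_prod s s"]) (auto simp: ss)
    ultimately show ?thesis unfolding inversions_def by (simp add: card_image)
  qed
  let ?K = "{i<..<j}"
  define a where "a = {k \<in> ?K. w k < w i}"
  define b where "b = {k \<in> ?K. w i < w k \<and> w k < w j}"
  define c where "c = {k \<in> ?K. w j < w k}"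
  have finabc: "finite a" "finite b" "finite c" by (auto simp: a_def b_def c_def)
  have strict: "w i < w k \<longleftrightarrow> w i \<le> w k" "w k < w j \<longleftrightarrow> w k \<le> w j" if "i < k" "k < j" for k
    using that injD[OF w, of k i] injD[OF w, of k j] by (auto simp: order_less_le)
  have YX: "Y - X = Pair j ` (a \<union> b) \<union> (\<lambda>p. (p, i)) ` (b \<union> c) \<union> {(j, i)}"
  proof (intro subset_antisym subsetI)
    fix z assume "z \<in> Y - X"
    then obtain p q where z: "z = (p, q)" "p \<in> {1..n}" "q \<in> {1..n}" "w q < w p" "s p < s q" "\<not> p < q"
      by (auto simp: X_def Y_def P_def)
    have "p \<noteq> q" using z by auto
    then have pq: "q < p" using z by auto
    have "p = j \<and> q = i \<or> p = j \<and> q \<in> ?K \<or> q = i \<and> p \<in> ?K"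
      using z(5) pq ij s by (cases "p = j"; cases "q = i"; cases "p = i"; cases "q = j") auto
    then show "z \<in> Pair j ` (a \<union> b) \<union> (\<lambda>p. (p, i)) ` (b \<union> c) \<union> {(j, i)}"
      using z strict[of p] strict[of q] by (auto simp: a_def b_def c_def not_less image_iff)
  next
    fix z assume "z \<in> Pair j ` (a \<union> b) \<union> (\<lambda>p. (p, i)) ` (b \<union> c) \<union> {(j, i)}"
    then show "z \<in> Y - X"
    proof (elim UnE[of _ "_ \<union> _"] UnE[of _ "_ ` _"] imageE singletonE)
      fix q assume "z = (j, q)" "q \<in> a \<union> b"
      then show ?thesis using ij less s(2) s(3)[of q] by (auto simp: X_def Y_def P_def a_def b_def)
    next
      fix p assume "z = (p, i)" "p \<in> b \<union> c"
      then show ?thesis using ij less s(1) s(3)[of p] by (auto simp: X_def Y_def P_def b_def c_def)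
    next
      assume "z = (j, i)"
      then show ?thesis using ij less s(1,2) by (simp add: X_def Y_def P_def)
    qed
  qed
  have XY: "X - Y = Pair i ` a \<union> (\<lambda>p. (p, j)) ` c"
  proof (intro subset_antisym subsetI)
    fix z assume "z \<in> X - Y"
    then obtain p q where z: "z = (p, q)" "p \<in> {1..n}" "q \<in> {1..n}" "w q < w p" "p < q" "\<not> s p < s q"
      by (auto simp: X_def Y_def P_def)
    have "p = i \<and> q = j \<or> p = i \<and> q \<in> ?K \<or> q = j \<and> p \<in> ?K"
      using z(5,6) ij s by (cases "p = j"; cases "q = i"; cases "p = i"; cases "q = j") auto
    then show "z \<in> Pair i ` a \<union> (\<lambda>p. (p, j)) ` c"
      using z less by (auto simp: a_def c_def)
  next
    fix z assume "z \<in> Pair i ` a \<union> (\<lambda>p. (p, j)) ` c"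
    then show "z \<in> X - Y"
    proof (elim UnE imageE)
      fix q assume "z = (i, q)" "q \<in> a"
      then show ?thesis using ij s(1) s(3)[of q] by (auto simp: X_def Y_def P_def a_def)
    next
      fix p assume "z = (p, j)" "p \<in> c"
      then show ?thesis using ij s(2) s(3)[of p] by (auto simp: X_def Y_def P_def c_def)
    qed
  qed
  have "card (Y - X) = card (a \<union> b) + card (b \<union> c) + 1"
  proof -
    have "card (Pair j ` (a \<union> b) \<union> (\<lambda>p. (p, i)) ` (b \<union> c) \<union> {(j, i)})
        = card (Pair j ` (a \<union> b) \<union> (\<lambda>p. (p, i)) ` (b \<union> c)) + card {(j, i)}"
      using finabc by (intro card_Un_disjoint) (auto simp: a_def b_def c_def)
    also have "card (Pair j ` (a \<union> b) \<union> (\<lambda>p. (p, i)) ` (b \<union> c))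
        = card (Pair j ` (a \<union> b)) + card ((\<lambda>p. (p, i)) ` (b \<union> c))"
      using finabc by (intro card_Un_disjoint) (auto simp: a_def b_def c_def)
    finally show ?thesis unfolding YX by (simp add: card_image inj_on_def)
  qed
  moreover have "card (X - Y) = card a + card c"
  proof -
    have "card (Pair i ` a \<union> (\<lambda>p. (p, j)) ` c) = card (Pair i ` a) + card ((\<lambda>p. (p, j)) ` c)"
      using finabc by (intro card_Un_disjoint) (auto simp: a_def b_def c_def)
    then show ?thesis unfolding XY by (simp add: card_image inj_on_def)
  qed
  moreover have "card (a \<union> b) = card a + card b" "card (b \<union> c) = card b + card c"
    using finabc by (auto intro!: card_Un_disjoint simp: a_def b_def c_def)
  moreover have "card Y + card (X - Y) = card X + card (Y - X)"
    using card_Diff_subset_Int[of X Y] card_Diff_subset_Int[of Y X] finX finY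
      card_mono[OF finX, of "X \<inter> Y"] card_mono[OF finY, of "X \<inter> Y"] by (simp add: Int_commute)
  ultimately show ?thesis
    unfolding X Y[unfolded s_def] b_def[symmetric] by linarith
qed

section \<open>Prefixes of a permutation and transpositions\<close>

lemma prefix_swap:
  fixes w :: "nat \<Rightarrow> 'a"
  assumes "inj w" "1 \<le> i" "i < j"
  shows "(w \<circ> transpose i j) ` {1..k} =
    (if i \<le> k \<and> k < j then insert (w j) (w ` {1..k} - {w i}) else w ` {1..k})"
proof -
  have "transpose i j ` {1..k} = (if i \<le> k \<and> k < j then insert j ({1..k} - {i}) else {1..k})"
  proof (cases "i \<le> k \<and> k < j")
    case True
    then have "j \<notin> {1..k} - {i}" by simp
    then have "transpose i j ` insert i ({1..k} - {i}) = insert j ({1..k} - {i})"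
      unfolding image_insert by (simp add: transpose_image_eq del: atLeastAtMost_iff)
    moreover have "insert i ({1..k} - {i}) = {1..k}" using True assms(2) by auto
    ultimately show ?thesis using True by (simp only: if_True simp_thms)
  next
    case False
    then have "i \<in> {1..k} \<longleftrightarrow> j \<in> {1..k}" using assms(2,3) by auto
    then show ?thesis using False by (simp only: transpose_image_eq if_False)
  qed
  then show ?thesis unfolding image_comp[symmetric]
    using assms(1) by (auto simp: image_set_diff)
qed

lemma prefix_subset:
  fixes k n :: nat
  assumes "w permutes {1..n}" "k \<le> n"
  shows "w ` {1..k} \<subseteq> {1..n}"
proof -
  have "w ` {1..k} \<subseteq> w ` {1..n}" using assms(2) by (intro image_mono) simp
  then show ?thesis unfolding permutes_image[OF assms(1)] .
qed

lemma card_prefix: "w permutes {1..n::nat} \<Longrightarrow> card (w ` {1..k}) = k"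
  by (simp add: card_image permutes_inj_on)

text \<open>A closed form for the distance in the quantum Bruhat graph, as \<open>qb_dist_eq\<close>
  shows. The sum makes up for the inversions that are lost along descending edges.\<close>

definition path_weight :: "nat \<Rightarrow> (nat \<Rightarrow> nat) \<Rightarrow> (nat \<Rightarrow> nat) \<Rightarrow> int" where
  "path_weight n u v = int (inversions n v) - int (inversions n u)
     + 2 * (\<Sum>k = 1..n. qdeg n (u ` {1..k}) (v ` {1..k}))"

lemma path_weight_self [simp]: "path_weight n u u = 0"
  by (simp add: path_weight_def)

lemma path_weight_triangle: "path_weight n u v \<le> path_weight n u w + path_weight n w v"
proof -
  have "(\<Sum>k = 1..n. qdeg n (u ` {1..k}) (v ` {1..k}))
      \<le> (\<Sum>k = 1..n. qdeg n (u ` {1..k}) (w ` {1..k}) + qdeg n (w ` {1..k}) (v ` {1..k}))"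
    by (intro sum_mono qdeg_triangle)
  then show ?thesis by (simp add: path_weight_def sum.distrib)
qed

text \<open>The inversion numbers cancel. What remains is a sum over \<open>k\<close> of nonnegative
  defects of the triangle inequality for \<open>qdeg\<close>.\<close>

lemma path_weight_additive_iff:
  "path_weight n u w + path_weight n w v = path_weight n u v
    \<longleftrightarrow> (\<forall>k\<in>{1..n}. qdeg n (u ` {1..k}) (w ` {1..k}) + qdeg n (w ` {1..k}) (v ` {1..k})
          = qdeg n (u ` {1..k}) (v ` {1..k}))"
proof -
  let ?d = "\<lambda>k. qdeg n (u ` {1..k}) (w ` {1..k}) + qdeg n (w ` {1..k}) (v ` {1..k})
          - qdeg n (u ` {1..k}) (v ` {1..k})"
  have "path_weight n u w + path_weight n w v = path_weight n u v \<longleftrightarrow> (\<Sum>k = 1..n. ?d k) = 0"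
    by (simp add: path_weight_def sum.distrib sum_subtractf) linarith
  also have "\<dots> \<longleftrightarrow> (\<forall>k\<in>{1..n}. ?d k = 0)"
    by (rule sum_nonneg_eq_0_iff) (auto intro: qdeg_triangle)
  finally show ?thesis by simp
qed

lemma qdeg_prefix_swap:
  assumes w: "w permutes {1..n}" and ij: "1 \<le> i" "i < j" "j \<le> n" and k: "k \<le> n"
  shows "qdeg n (w ` {1..k}) ((w \<circ> transpose i j) ` {1..k}) = of_bool (k \<in> {i..<j} \<and> w j < w i)"
proof (cases "k \<in> {i..<j}")
  case True
  have inj: "inj w" using permutes_inj[OF w] .
  have "w j \<notin> w ` {1..k}" using True by (auto simp: inj_eq[OF inj])
  moreover have "w j \<in> {1..n}" using permutes_in_image[OF w, of j] ij by simp
  moreover have "w i \<in> w ` {1..k}" using True ij by auto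
  ultimately have "qdeg n (w ` {1..k}) (insert (w j) (w ` {1..k} - {w i})) = of_bool (w j < w i)"
    using qdeg_swap_right[OF prefix_subset[OF w k]] by blast
  then show ?thesis unfolding prefix_swap[OF inj ij(1,2)] using True by simp
next
  case False
  then show ?thesis unfolding prefix_swap[OF permutes_inj[OF w] ij(1,2)] by auto
qed

lemma path_weight_swap:
  assumes w: "w permutes {1..n}" and ij: "1 \<le> i" "i < j" "j \<le> n"
  shows "path_weight n w (w \<circ> transpose i j)
    = int (inversions n (w \<circ> transpose i j)) - int (inversions n w)
      + (if w j < w i then 2 * int (j - i) else 0)"
proof -
  have "(\<Sum>k = 1..n. qdeg n (w ` {1..k}) ((w \<circ> transpose i j) ` {1..k}))
      = (\<Sum>k = 1..n. of_bool (k \<in> {i..<j} \<and> w j < w i))"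
    by (rule sum.cong) (use qdeg_prefix_swap[OF assms] in auto)
  also have "\<dots> = int (card {k \<in> {1..n}. k \<in> {i..<j} \<and> w j < w i})"
    by (simp add: of_bool_def sum.If_cases Int_def)
  also have "{k \<in> {1..n}. k \<in> {i..<j} \<and> w j < w i} = (if w j < w i then {i..<j} else {})"
    using ij by auto
  finally show ?thesis by (simp add: path_weight_def)
qed

text \<open>The swapped permutation has an ascent at \<open>i, j\<close>, and swapping again gives
  back \<open>w\<close>, so \<open>inversions_swap\<close> applies to it.\<close>

lemma inversions_swap_descent:
  assumes w: "inj w" and ij: "1 \<le> i" "i < j" "j \<le> n" and less: "w j < w i"
  shows "inversions n w = inversions n (w \<circ> transpose i j) + 1
    + 2 * card {k \<in> {i<..<j}. w j < w k \<and> w k < w i}"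
proof -
  let ?w = "w \<circ> transpose i j"
  have "inj ?w" using w by (simp add: inj_compose)
  moreover have "?w \<circ> transpose i j = w" by (simp add: fun_eq_iff)
  moreover have "?w i = w j" "?w j = w i" by simp_all
  moreover have "{k \<in> {i<..<j}. w j < ?w k \<and> ?w k < w i} = {k \<in> {i<..<j}. w j < w k \<and> w k < w i}"
    by (auto simp: transpose_def split: if_splits)
  ultimately show ?thesis using inversions_swap[of ?w i j n] ij less by simp
qed

text \<open>An ascent increases the number of inversions, which leaves only the alternative
  \<open>+ 1\<close>, and \<open>qdeg\<close> contributes nothing. A descent decreases it, which
  leaves only \<open>1 - 2 * (j - i)\<close>, and \<open>qdeg\<close> contributes 1 for each of the
  \<open>j - i\<close> changed prefixes.\<close>

lemma path_weight_edge:
  assumes "(x, y) \<in> quantum_bruhat_graph n"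
  shows "path_weight n x y = 1"
proof -
  obtain i j where y: "y = x \<circ> transpose i j" and x: "x permutes {1..n}"
    and ij: "1 \<le> i" "i < j" "j \<le> n"
    and len: "int (inversions n y) = int (inversions n x) + 1 \<or>
      int (inversions n y) = int (inversions n x) + 1 - 2 * int (j - i)"
    using assms by (auto simp: quantum_bruhat_graph_def)
  have "x i \<noteq> x j" using permutes_inj[OF x] ij by (auto dest: injD)
  then consider "x i < x j" | "x j < x i" by linarith
  then show ?thesis
  proof cases
    case 1
    have "inversions n x < inversions n y"
      using inversions_swap[OF permutes_inj[OF x] ij 1] by (simp add: y)
    then show ?thesis using path_weight_swap[OF x ij] 1 len ij by (simp add: y)
  next
    case 2
    have "inversions n y < inversions n x"
      using inversions_swap_descent[OF permutes_inj[OF x] ij 2] by (simp add: y)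
    then show ?thesis using path_weight_swap[OF x ij] 2 len ij by (simp add: y)
  qed
qed

section \<open>Comparison of the weight with the length of paths\<close>

lemma path_weight_le_length: "(x, y) \<in> quantum_bruhat_graph n ^^ m \<Longrightarrow> path_weight n x y \<le> int m"
proof (induction m arbitrary: y)
  case (Suc m)
  then obtain z where "(x, z) \<in> quantum_bruhat_graph n ^^ m" "(z, y) \<in> quantum_bruhat_graph n" by auto
  then show ?case
    using Suc.IH[of z] path_weight_edge[of z y n] path_weight_triangle[of n x y z] by simp
qed simp

text \<open>Taking the first \<open>j\<close> whose value lies on the arc from \<open>u i\<close> to
  \<open>v i\<close> serves twice: the positions between \<open>i\<close> and \<open>j\<close> have
  values off the arc, which yields the edge condition, and every changed prefix meets the arc only
  where \<open>u\<close> and \<open>v\<close> agree, as \<open>qdeg_step\<close> demands.\<close>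

lemma geodesic_step:
  assumes u: "u permutes {1..n}" and v: "v permutes {1..n}" and neq: "u \<noteq> v"
  obtains u' where "(u, u') \<in> quantum_bruhat_graph n"
    "path_weight n u u' + path_weight n u' v = path_weight n u v"
proof -
  have inju: "inj u" and injv: "inj v" using u v permutes_inj by auto
  define i where "i = (LEAST i. u i \<noteq> v i)"
  have ex: "\<exists>i. u i \<noteq> v i" using neq by auto
  have i: "u i \<noteq> v i" unfolding i_def using LeastI_ex[OF ex] .
  have before_i: "u p = v p" if "p < i" for p
    using not_less_Least[of p "\<lambda>i. u i \<noteq> v i"] that unfolding i_def by blast
  have iN: "i \<in> {1..n}" using i u v by (metis permutes_not_in)
  have x: "u i \<in> {1..n}" and z: "v i \<in> {1..n}"
    using iN permutes_in_image[OF u] permutes_in_image[OF v] by blast+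
  have z_arc: "v i \<in> arc n (u i) (v i)" using i x z by (auto simp: arc_def)
  have x_arc: "u i \<notin> arc n (u i) (v i)" using i by (auto simp: arc_def)
  obtain j0 where j0: "u j0 = v i" using permutes_surj[OF u] by (metis surjD)
  \<comment> \<open>To the left of \<open>i\<close> the two permutations agree, so the value
    \<open>v i\<close> cannot occur there in \<open>u\<close>.\<close>
  have "i < j0"
    using before_i[of j0] j0 i injD[OF injv, of j0 i] by (cases j0 i rule: linorder_cases) auto
  then have ex: "\<exists>j. i < j \<and> u j \<in> arc n (u i) (v i)" using j0 z_arc by auto
  define j where "j = (LEAST j. i < j \<and> u j \<in> arc n (u i) (v i))"
  have j: "i < j" "u j \<in> arc n (u i) (v i)" using LeastI_ex[OF ex] unfolding j_def by auto
  have before_j: "u p \<notin> arc n (u i) (v i)" if "i < p" "p < j" for p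
    using not_less_Least[of p "\<lambda>j. i < j \<and> u j \<in> arc n (u i) (v i)"] that unfolding j_def by blast
  have "u j \<in> {1..n}" using j x z by (auto simp: arc_def split: if_splits)
  then have "j \<in> {1..n}" using permutes_in_image[OF u] by blast
  then have ij: "1 \<le> i" "i < j" "j \<le> n" using iN j by auto
  define u' where "u' = u \<circ> transpose i j"
  have edge: "(u, u') \<in> quantum_bruhat_graph n"
  proof -
    have uij: "u i \<noteq> u j" using injD[OF inju] ij by auto
    have "int (inversions n u') = int (inversions n u) + 1 \<or>
      int (inversions n u') = int (inversions n u) + 1 - 2 * int (j - i)"
    proof (cases "u i < u j")
      case True
      \<comment> \<open>All values between \<open>u i\<close> and \<open>u j\<close> lie on the arc,
        and none of them occurs before position \<open>j\<close>.\<close>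
      have "{k \<in> {i<..<j}. u i < u k \<and> u k < u j} = {}"
        using before_j j True x by (force simp: arc_def split: if_splits)
      then show ?thesis using inversions_swap[OF inju ij True] by (simp add: u'_def)
    next
      case False
      then have less: "u j < u i" using uij by auto
      \<comment> \<open>Here the arc wraps past \<open>n\<close> and \<open>u j \<le> v i\<close>. A
        value off the arc and different from \<open>u i\<close> lies strictly between
        \<open>v i\<close> and \<open>u i\<close>.\<close>
      have "{k \<in> {i<..<j}. u j < u k \<and> u k < u i} = {i<..<j}"
      proof -
        have "u j < u k \<and> u k < u i" if k: "k \<in> {i<..<j}" for k
        proof -
          have "k \<in> {1..n}" using k ij by auto
          then have "u k \<in> {1..n}" using permutes_in_image[OF u] by blast
          moreover have "u k \<noteq> u i" "u k \<noteq> u j" using injD[OF inju] k by auto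
          ultimately show ?thesis
            using before_j[of k] k j less by (auto simp: arc_def split: if_splits)
        qed
        then show ?thesis by blast
      qed
      then have "inversions n u = inversions n u' + 1 + 2 * (j - i - 1)"
        using inversions_swap_descent[OF inju ij less] by (simp add: u'_def)
      then show ?thesis using ij by (intro disjI2) linarith
    qed
    then show ?thesis unfolding quantum_bruhat_graph_def u'_def using u ij by blast
  qed
  moreover have "path_weight n u u' + path_weight n u' v = path_weight n u v"
    unfolding path_weight_additive_iff
  proof
    fix k assume k: "k \<in> {1..n}"
    show "qdeg n (u ` {1..k}) (u' ` {1..k}) + qdeg n (u' ` {1..k}) (v ` {1..k})
        = qdeg n (u ` {1..k}) (v ` {1..k})"
    proof (cases "i \<le> k \<and> k < j")
      case True
      have u': "u' ` {1..k} = insert (u j) (u ` {1..k} - {u i})"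
        using prefix_swap[OF inju ij(1,2), of k] True by (simp add: u'_def)
      \<comment> \<open>Elements of \<open>u[k]\<close> on the arc come from positions before
        \<open>i\<close>. They therefore belong to \<open>v[k]\<close>, and \<open>v i\<close> is
        not among them.\<close>
      have arc: "p < i" if "p \<le> k" "u p \<in> arc n (u i) (v i)" for p
        using that before_j[of p] x_arc True by (cases p i rule: linorder_cases) auto
      show ?thesis unfolding u'
      proof (rule qdeg_step)
        have "k \<le> n" using k by simp
        then show "u ` {1..k} \<subseteq> {1..n}" "v ` {1..k} \<subseteq> {1..n}"
          using prefix_subset u v by blast+
        show "card (u ` {1..k}) = card (v ` {1..k})"
          unfolding card_prefix[OF u] card_prefix[OF v] ..
        show "u i \<in> u ` {1..k}" using True ij by auto
        show "u j \<notin> u ` {1..k}" using True by (auto simp: inj_eq[OF inju])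
        show "u j \<in> arc n (u i) (v i)" by (rule j)
        show "v i \<in> v ` {1..k} - u ` {1..k}"
        proof -
          have "u p \<noteq> v i" if "p \<le> k" for p
            using arc[OF that] before_i[of p] z_arc injD[OF injv, of p i] by fastforce
          then have "v i \<notin> u ` {1..k}" by (metis atLeastAtMost_iff imageE)
          then show ?thesis using True ij by simp
        qed
        show "arc n (u i) (v i) \<inter> u ` {1..k} \<subseteq> v ` {1..k}"
          using arc before_i by fastforce
      qed
    next
      case False
      then have "u' ` {1..k} = u ` {1..k}"
        using prefix_swap[OF inju ij(1,2), of k] by (auto simp: u'_def)
      then show ?thesis by simp
    qed
  qed
  ultimately show ?thesis by (rule that)
qed

lemma inversions_le: "inversions n w \<le> n * n"
proof -
  have "card {(i, j). 1 \<le> i \<and> i < j \<and> j \<le> n \<and> w j < w i} \<le> card ({1..n} \<times> {1..n})"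
    by (rule card_mono) auto
  then show ?thesis by (simp add: inversions_def)
qed

lemma path_weight_ge: "- int (n * n) \<le> path_weight n u v"
proof -
  have "0 \<le> (\<Sum>k = 1..n. qdeg n (u ` {1..k}) (v ` {1..k}))" by (intro sum_nonneg qdeg_nonneg)
  moreover have "int (inversions n u) \<le> int (n * n)" using inversions_le by (simp only: of_nat_le_iff)
  ultimately show ?thesis unfolding path_weight_def by linarith
qed

text \<open>Iterating \<open>geodesic_step\<close> uses up one unit of weight per edge, so the path
  reaches \<open>v\<close> after exactly \<open>path_weight n u v\<close> edges.\<close>

lemma geodesic_ex:
  assumes "u permutes {1..n}" "v permutes {1..n}"
  shows "\<exists>m. (u, v) \<in> quantum_bruhat_graph n ^^ m \<and> path_weight n u v = int m"
  using assms(1)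
\<comment> \<open>The weight is not yet known to be nonnegative; the shift by \<open>n * n\<close>
  turns it into a measure with natural values, by \<open>path_weight_ge\<close>.\<close>
proof (induction "nat (path_weight n u v + int (n * n))" arbitrary: u rule: less_induct)
  case less
  show ?case
  proof (cases "u = v")
    case True
    then show ?thesis by (intro exI[of _ 0]) simp
  next
    case False
    obtain u' where u': "(u, u') \<in> quantum_bruhat_graph n"
      "path_weight n u u' + path_weight n u' v = path_weight n u v"
      using geodesic_step[OF less.prems assms(2) False] .
    then have w: "path_weight n u v = 1 + path_weight n u' v" using path_weight_edge by fastforce
    have "u' permutes {1..n}"
      using u'(1) by (auto simp: quantum_bruhat_graph_def intro!: permutes_compose permutes_swap_id)
    moreover have "nat (path_weight n u' v + int (n * n)) < nat (path_weight n u v + int (n * n))"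
      using w path_weight_ge[of n u' v] by simp
    ultimately obtain m where m: "(u', v) \<in> quantum_bruhat_graph n ^^ m" "path_weight n u' v = int m"
      using less.hyps by blast
    have "(u, v) \<in> quantum_bruhat_graph n ^^ Suc m" using relpow_Suc_I2[OF u'(1) m(1)] .
    then show ?thesis using w m(2) by (intro exI[of _ "Suc m"]) simp
  qed
qed

lemma qb_dist_eq:
  assumes "u permutes {1..n}" "v permutes {1..n}"
  shows "int (qb_dist n u v) = path_weight n u v"
proof -
  obtain m where m: "(u, v) \<in> quantum_bruhat_graph n ^^ m" "path_weight n u v = int m"
    using geodesic_ex[OF assms] by blast
  have "(LEAST m. (u, v) \<in> quantum_bruhat_graph n ^^ m) = m"
  proof (rule Least_equality)
    fix m' assume "(u, v) \<in> quantum_bruhat_graph n ^^ m'"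
    then show "m \<le> m'" using path_weight_le_length m(2) by fastforce
  qed (rule m(1))
  then show ?thesis using m(2) by (simp add: qb_dist_def)
qed

lemma tilted_interval_iff:
  assumes "u permutes {1..n}" "v permutes {1..n}" "w permutes {1..n}"
  shows "w \<in> tilted_interval n u v
    \<longleftrightarrow> (\<forall>k\<in>{1..n}. qdeg n (u ` {1..k}) (w ` {1..k}) + qdeg n (w ` {1..k}) (v ` {1..k})
          = qdeg n (u ` {1..k}) (v ` {1..k}))"
  unfolding path_weight_additive_iff[symmetric] tilted_interval_def
  using assms qb_dist_eq[OF assms(1,3)] qb_dist_eq[OF assms(3,2)] qb_dist_eq[OF assms(1,2)]
  by simp linarith

section \<open>Bases of a family of vectors\<close>

text \<open>All vectors live in one space of functions on \<open>nat\<close>. Rows cut off at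
  different lengths are then comparable, and the cut-off \<open>trunc\<close> is a linear map of
  this space to itself.\<close>

definition fun_scale :: "'a::field \<Rightarrow> (nat \<Rightarrow> 'a) \<Rightarrow> nat \<Rightarrow> 'a" where
  "fun_scale c g = (\<lambda>j. c * g j)"

interpretation fv: vector_space fun_scale
  by unfold_locales (auto simp: fun_scale_def plus_fun_def algebra_simps)

definition trunc :: "nat \<Rightarrow> (nat \<Rightarrow> 'a::field) \<Rightarrow> nat \<Rightarrow> 'a" where
  "trunc k g = (\<lambda>j. if j < k then g j else 0)"

interpretation trunc: Vector_Spaces.linear fun_scale fun_scale "trunc k" for k
  by unfold_locales (auto simp: trunc_def fun_scale_def plus_fun_def)

lemma trunc_trunc: "k \<le> l \<Longrightarrow> trunc k (trunc l g) = trunc k g"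
  by (auto simp: trunc_def)

section \<open>The rank of a matrix as the dimension of its row span\<close>

lemma sum_fun_apply: "(\<Sum>x\<in>A. f x) j = (\<Sum>x\<in>A. (f x :: 'b \<Rightarrow> 'c::comm_monoid_add) j)"
  by (induction A rule: infinite_finite_induct) (auto simp: plus_fun_def zero_fun_def)

lemma (in vec_space) card_le_of_subset_span:
  assumes "finite U" "lin_indpt U" "finite W" "W \<subseteq> carrier_vec n" "U \<subseteq> span W"
  shows "card U \<le> card W"
  using replacement[OF assms(1,3,4,2,5)] by auto

text \<open>Column rank equals row rank, across two encodings of vectors. Expanding the columns in
  \<open>d\<close> of them factors the matrix through dimension \<open>d\<close>, which puts the
  rows in the span of \<open>d\<close> vectors; the other inequality is the same argument for
  rows.\<close>

lemma rank_mat_eq_dim: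
  fixes f :: "nat \<Rightarrow> nat \<Rightarrow> 'a::field"
  shows "vec_space.rank m (mat m k (\<lambda>(i, j). f i j)) = fv.dim ((\<lambda>i. trunc k (f i)) ` {..<m})"
    (is "_ = fv.dim ?R")
proof -
  interpret vec_space "TYPE('a)" m .
  define A where "A = mat m k (\<lambda>(i, j). f i j)"
  have A: "A \<in> carrier_mat m k" by (simp add: A_def)
  have cols: "set (cols A) \<subseteq> carrier_vec m" using cols_dim A by blast
  obtain S where max: "maximal S (\<lambda>T. T \<subseteq> set (cols A) \<and> lin_indpt T)"
    using maximal_exists[of "\<lambda>T. T \<subseteq> set (cols A) \<and> lin_indpt T" "card (set (cols A))" "{}"]
    by (meson List.finite_set card_mono empty_iff empty_subsetI finite_lin_indpt2 rev_finite_subset)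
  have S: "S \<subseteq> set (cols A)" "lin_indpt S" using max by (auto simp: maximal_def)
  then have finS: "finite S" and Sc: "S \<subseteq> carrier_vec m"
    using cols finite_subset by auto
  have r: "rank A = card S" by (rule rank_card_indpt[OF A max])
  have "fv.dim ?R \<le> rank A"
  proof -
    have "\<exists>g. \<forall>i<m. f i j = (\<Sum>s\<in>S. g s * s $ i)" if j: "j < k" for j
    proof -
      have c: "col A j \<in> set (cols A)" using j A by (auto simp: cols_def)
      have "col A j \<in> span S"
      proof (rule ccontr)
        assume n: "col A j \<notin> span S"
        then have nS: "col A j \<notin> S" using in_own_span Sc by auto
        have "lin_indpt (S \<union> {col A j})"
          using lin_dep_iff_in_span[of S "col A j"] Sc S nS n c cols by auto
        then have "S \<union> {col A j} = S" using max S c unfolding maximal_def by blast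
        then show False using nS by auto
      qed
      then obtain g where g: "lincomb g S = col A j" using finite_in_span[OF finS] Sc by auto
      have "f i j = (\<Sum>s\<in>S. g s * s $ i)" if i: "i < m" for i
        using lincomb_index[OF i Sc, of g] g i j by (simp add: A_def)
      then show ?thesis by blast
    qed
    then obtain g where g: "\<And>i j. j < k \<Longrightarrow> i < m \<Longrightarrow> f i j = (\<Sum>s\<in>S. g j s * s $ i)" by metis
    \<comment> \<open>The second factor: row \<open>i\<close> is the combination of the vectors
      \<open>h s\<close> with coefficients \<open>s $ i\<close>.\<close>
    define h where "h s = (\<lambda>j. if j < k then g j s else 0)" for s
    have "trunc k (f i) \<in> fv.span (h ` S)" if i: "i < m" for i
    proof -
      have "trunc k (f i) = (\<Sum>s\<in>S. fun_scale (s $ i) (h s))"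
        by (rule ext) (auto simp: trunc_def sum_fun_apply fun_scale_def h_def g i mult.commute)
      then show ?thesis by (simp add: fv.span_sum fv.span_scale fv.span_base)
    qed
    then have "fv.dim ?R \<le> card (h ` S)" by (intro fv.dim_le_card) (auto simp: finS)
    also have "\<dots> \<le> card S" using finS by (rule card_image_le)
    finally show ?thesis using r by simp
  qed
  moreover have "rank A \<le> fv.dim ?R"
  proof -
    obtain B where B: "B \<subseteq> ?R" "?R \<subseteq> fv.span B" "card B = fv.dim ?R"
      by (rule fv.basis_exists)
    have finB: "finite B" using B(1) finite_subset by blast
    have "\<exists>c. trunc k (f i) = (\<Sum>b\<in>B. fun_scale (c b) b)" if "i < m" for i
      using B(2) that fv.span_finite[OF finB] by auto
    then obtain c where c: "\<And>i. i < m \<Longrightarrow> trunc k (f i) = (\<Sum>b\<in>B. fun_scale (c i b) b)" by metis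
    define h where "h b = vec m (\<lambda>i. c i b)" for b
    have hB: "h ` B \<subseteq> carrier_vec m" by (auto simp: h_def)
    have "S \<subseteq> span (h ` B)"
    proof
      fix x assume "x \<in> S"
      then obtain j where j: "j < k" "x = col A j" using S A by (auto simp: cols_def)
      \<comment> \<open>Different \<open>b\<close> may have the same image under \<open>h\<close>,
        so their coefficients are added up.\<close>
      define d where "d w = (\<Sum>b | b \<in> B \<and> h b = w. b j)" for w
      have dim: "dim_vec (lincomb d (h ` B)) = m" using finB by (intro lincomb_dim hB) simp
      have "x = lincomb d (h ` B)"
      proof (rule eq_vecI)
        show "dim_vec x = dim_vec (lincomb d (h ` B))" using j A dim by simp
        fix i assume "i < dim_vec (lincomb d (h ` B))"
        then have i: "i < m" using dim by simp
        have "x $ i = trunc k (f i) j" using i j by (simp add: A_def trunc_def)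
        also have "\<dots> = (\<Sum>b\<in>B. c i b * b j)" using c[OF i] by (simp add: sum_fun_apply fun_scale_def)
        also have "\<dots> = (\<Sum>w\<in>h ` B. \<Sum>b | b \<in> B \<and> h b = w. c i b * b j)"
          by (rule sum.image_gen[OF finB])
        also have "\<dots> = (\<Sum>w\<in>h ` B. d w * w $ i)"
          unfolding d_def sum_distrib_right
          by (intro sum.cong) (auto simp: h_def i mult.commute)
        finally show "x $ i = lincomb d (h ` B) $ i" using lincomb_index[OF i hB] by simp
      qed
      then show "x \<in> span (h ` B)" using finB by (intro in_spanI) auto
    qed
    then have "card S \<le> card (h ` B)"
      using card_le_of_subset_span[OF finS S(2) _ hB] finB by blast
    also have "\<dots> \<le> card B" using finB by (rule card_image_le)
    finally show ?thesis using r B(3) by simp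
  qed
  ultimately show ?thesis by (simp add: A_def)
qed

lemma pick_image: "pick I ` {..<card {i. i < n \<and> i \<in> I}} = {i. i < n \<and> i \<in> I}"
proof (intro subset_antisym subsetI)
  fix x assume "x \<in> pick I ` {..<card {i. i < n \<and> i \<in> I}}"
  then obtain t where t: "t < card {i. i < n \<and> i \<in> I}" "x = pick I t" by auto
  have "x < n" using pick_le[OF t(1)] t(2) by simp
  moreover have "x \<in> I"
  proof (cases "finite I")
    case True
    then have "card {i. i < n \<and> i \<in> I} \<le> card I" by (intro card_mono) auto
    then show ?thesis using t pick_in_set_le by auto
  next
    case False
    then show ?thesis using t pick_in_set_inf by auto
  qed
  ultimately show "x \<in> {i. i < n \<and> i \<in> I}" by simp
next
  fix x assume x: "x \<in> {i. i < n \<and> i \<in> I}"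
  have "card {a \<in> I. a < x} < card {i. i < n \<and> i \<in> I}"
    using x by (intro psubset_card_mono) auto
  then show "x \<in> pick I ` {..<card {i. i < n \<and> i \<in> I}}"
    using pick_card_in_set[of x I] x by (intro image_eqI[of _ _ "card {a \<in> I. a < x}"]) auto
qed

lemma rank_submatrix_eq_dim:
  fixes M :: "'a::field mat"
  assumes M: "M \<in> carrier_mat n n" and k: "k \<le> n"
  shows "vec_space.rank (dim_row (submatrix M I {..<k})) (submatrix M I {..<k})
    = fv.dim ((\<lambda>i. trunc k (\<lambda>j. M $$ (i, j))) ` {i. i < n \<and> i \<in> I})"
proof -
  let ?m = "card {i. i < n \<and> i \<in> I}"
  have kk: "{j. j < n \<and> j \<in> {..<k}} = {..<k}" using k by auto
  have pk: "pick {..<k} j = j" if "j < k" for j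
    using pick_card_in_set[of j "{..<k}"] that by (simp add: Collect_conj_eq Int_absorb1 lessThan_def[symmetric] subset_eq)
  have "submatrix M I {..<k} = mat ?m k (\<lambda>(i, j). M $$ (pick I i, j))"
    using M kk pk by (auto simp: submatrix_def)
  moreover have "(\<lambda>i. trunc k (\<lambda>j. M $$ (pick I i, j))) ` {..<?m}
      = (\<lambda>i. trunc k (\<lambda>j. M $$ (i, j))) ` pick I ` {..<?m}"
    by (simp add: image_image)
  ultimately show ?thesis
    using rank_mat_eq_dim[of ?m k "\<lambda>i j. M $$ (pick I i, j)"] by (simp add: pick_image)
qed

text \<open>Bases of the linear matroid on the index set \<open>N\<close>. Injectivity is demanded
  because two indices carrying the same vector are dependent, although the image does not show
  it.\<close>

definition family_basis :: "('i \<Rightarrow> nat \<Rightarrow> 'a::field) \<Rightarrow> 'i set \<Rightarrow> 'i set \<Rightarrow> bool" where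
  "family_basis r N I \<longleftrightarrow> I \<subseteq> N \<and> inj_on r I \<and> fv.independent (r ` I) \<and> r ` N \<subseteq> fv.span (r ` I)"

lemma family_basis_card: "family_basis r N I \<Longrightarrow> card I = fv.dim (r ` N)"
  using fv.basis_card_eq_dim[of "r ` I" "r ` N"] by (auto simp: family_basis_def card_image image_mono)

text \<open>From right to left, a basis of the span of the chosen vectors has as many elements as
  \<open>I\<close>, so it consists of all of them without repetition. Extending it to a basis for
  all of \<open>N\<close> adds nothing, again by counting.\<close>

lemma family_basis_iff:
  assumes "finite N"
  shows "family_basis r N I \<longleftrightarrow> I \<subseteq> N \<and> card I = fv.dim (r ` I) \<and> fv.dim (r ` I) = fv.dim (r ` N)"
proof
  assume B: "family_basis r N I"
  then have "fv.dim (r ` I) = card (r ` I)" "card (r ` I) = card I" "I \<subseteq> N"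
    by (auto simp: family_basis_def fv.dim_eq_card_independent card_image)
  then show "I \<subseteq> N \<and> card I = fv.dim (r ` I) \<and> fv.dim (r ` I) = fv.dim (r ` N)"
    using family_basis_card[OF B] by simp
next
  assume I: "I \<subseteq> N \<and> card I = fv.dim (r ` I) \<and> fv.dim (r ` I) = fv.dim (r ` N)"
  then have finI: "finite I" using assms finite_subset by blast
  obtain B where B: "B \<subseteq> r ` I" "fv.independent B" "r ` I \<subseteq> fv.span B" "card B = fv.dim (r ` I)"
    by (rule fv.basis_exists)
  have "card B \<le> card (r ` I)" using B(1) finI by (intro card_mono) auto
  then have eq: "card (r ` I) = card I" using card_image_le[OF finI, of r] B(4) I by simp
  then have inj: "inj_on r I" using finI by (simp add: eq_card_imp_inj_on)
  have "B = r ` I" using B(1,4) eq I finI by (intro card_subset_eq) auto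
  then have ind: "fv.independent (r ` I)" using B by simp
  obtain C where C: "r ` I \<subseteq> C" "C \<subseteq> r ` N" "fv.independent C" "r ` N \<subseteq> fv.span C"
    using fv.maximal_independent_subset_extend[of "r ` I" "r ` N"] I ind by (auto intro: image_mono)
  have "card C = fv.dim (r ` N)" using fv.basis_card_eq_dim C by blast
  moreover have "finite C" using C(2) assms finite_subset by blast
  ultimately have "r ` I = C" using C(1) I eq by (intro card_subset_eq) auto
  then show "family_basis r N I" using C I inj by (simp add: family_basis_def)
qed

lemma family_basis_extend:
  assumes "J \<subseteq> N" "inj_on r J" "fv.independent (r ` J)"
  obtains I where "J \<subseteq> I" "family_basis r N I"
proof -
  obtain C where C: "r ` J \<subseteq> C" "C \<subseteq> r ` N" "fv.independent C" "r ` N \<subseteq> fv.span C"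
    using fv.maximal_independent_subset_extend[of "r ` J" "r ` N"] assms by (auto intro: image_mono)
  then have "C - r ` J \<subseteq> r ` N" by auto
  then obtain K where K: "K \<subseteq> N" "inj_on r K" "C - r ` J = r ` K"
    by (auto simp: subset_image_inj)
  have rJK: "r ` (J \<union> K) = C" using C(1) K(3) by (auto simp: image_Un)
  have "inj_on r (J \<union> K)" using assms(2) K by (auto simp: inj_on_Un)
  then have "family_basis r N (J \<union> K)" using assms(1) K C by (simp add: family_basis_def rJK)
  then show ?thesis using that[of "J \<union> K"] by blast
qed

lemma card_family_basis_Int_le:
  assumes "finite N" "family_basis r N I" "S \<subseteq> N"
  shows "card (I \<inter> S) \<le> fv.dim (r ` S)"
proof -
  have inj: "inj_on r (I \<inter> S)" and ind: "fv.independent (r ` (I \<inter> S))"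
    using assms(2) fv.independent_mono[of "r ` I" "r ` (I \<inter> S)"]
    by (auto simp: family_basis_def intro: inj_on_subset)
  obtain C where "C \<subseteq> r ` S" "r ` S \<subseteq> fv.span C" "card C = fv.dim (r ` S)" by (rule fv.basis_exists)
  moreover have "finite C" using calculation(1) assms(1,3) by (meson finite_imageI finite_subset)
  moreover have "r ` (I \<inter> S) \<subseteq> fv.span C" using calculation by auto
  ultimately have "card (r ` (I \<inter> S)) \<le> fv.dim (r ` S)"
    using fv.independent_span_bound[OF _ ind] by metis
  then show ?thesis by (simp add: card_image[OF inj])
qed

text \<open>A basis of \<open>S\<close> extends to one of \<open>N\<close>. Together with
  \<open>card_family_basis_Int_le\<close> this makes the dimension for \<open>S\<close> the maximum
  of the sizes of \<open>I \<inter> S\<close> over all bases \<open>I\<close>.\<close>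

lemma family_basis_attains_dim:
  assumes "finite N" "S \<subseteq> N"
  obtains I where "family_basis r N I" "card (I \<inter> S) = fv.dim (r ` S)"
proof -
  obtain J where J: "family_basis r S J"
    using family_basis_extend[of "{}" S r] fv.independent_empty by auto
  then have JS: "J \<subseteq> S" "inj_on r J" "fv.independent (r ` J)" by (auto simp: family_basis_def)
  then obtain I where I: "J \<subseteq> I" "family_basis r N I"
    using family_basis_extend[of J N r] assms(2) by blast
  have "finite (I \<inter> S)" using assms finite_subset by blast
  then have "card J \<le> card (I \<inter> S)" using I JS by (intro card_mono) auto
  then show ?thesis
    using that[OF I(2)] card_family_basis_Int_le[OF assms(1) I(2) assms(2)] family_basis_card[OF J]
    by simp
qed

text \<open>
  The dimension of the span of \<open>{x \<in> N. p x < t}\<close> jumps exactly at the elements of \<open>U\<close>, so no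
  element of \<open>U\<close> is in the span of its predecessors.
\<close>

lemma family_basis_greedy:
  fixes p :: "'i \<Rightarrow> nat"
  assumes fin: "finite N" and U: "U \<subseteq> N" and p: "inj_on p N"
    and dim: "\<And>t. fv.dim (r ` {x \<in> N. p x < t}) = card (U \<inter> {x \<in> N. p x < t})"
  shows "family_basis r N U"
proof -
  define S where "S t = {x \<in> N. p x < t}" for t
  have step: "family_basis r (S t) (U \<inter> S t)" for t
  proof (induction t)
    case 0
    show ?case by (simp add: S_def family_basis_def fv.independent_empty)
  next
    case (Suc t)
    have finS: "finite (S t')" for t' using fin by (simp add: S_def)
    show ?case
    proof (cases "\<exists>x\<in>N. p x = t")
      case False
      then have "S (Suc t) = S t" by (auto simp: S_def less_Suc_eq)
      then show ?thesis using Suc.IH by simp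
    next
      case True
      then obtain x where x: "x \<in> N" "p x = t" by auto
      then have S: "S (Suc t) = insert x (S t)" "x \<notin> S t"
        using p by (auto simp: S_def less_Suc_eq dest: inj_onD)
      note IH = Suc.IH[unfolded family_basis_def]
      have span: "fv.span (r ` S t) = fv.span (r ` (U \<inter> S t))"
        using IH by (metis Int_lower2 image_mono fv.span_mono fv.span_span subset_antisym)
      have d: "fv.dim (r ` S (Suc t)) = card (U \<inter> S (Suc t))" "fv.dim (r ` S t) = card (U \<inter> S t)"
        using dim by (simp_all add: S_def)
      show ?thesis
      proof (cases "x \<in> U")
        case True
        have c: "card (U \<inter> S (Suc t)) = Suc (card (U \<inter> S t))"
          using True S finS[of t] by (simp add: Int_insert_right)
        have nsp: "r x \<notin> fv.span (r ` S t)"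
        proof
          assume "r x \<in> fv.span (r ` S t)"
          then have "fv.span (r ` S (Suc t)) = fv.span (r ` S t)"
            using fv.span_redundant by (simp add: S(1))
          then have "fv.dim (r ` S (Suc t)) = fv.dim (r ` S t)" by (rule fv.span_eq_dim)
          then show False using d c by simp
        qed
        let ?A = "r ` (U \<inter> S t)"
        have nsp': "r x \<notin> fv.span ?A" using nsp span by simp
        then have nA: "r x \<notin> ?A" using fv.span_base[of "r x" ?A] by argo
        have eq: "U \<inter> S (Suc t) = insert x (U \<inter> S t)" using True S by auto
        have "r ` S t \<subseteq> fv.span ?A" using IH by simp
        also have "\<dots> \<subseteq> fv.span (insert (r x) ?A)" by (rule fv.span_mono) (rule subset_insertI)
        finally have "r ` S (Suc t) \<subseteq> fv.span (insert (r x) ?A)"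
          unfolding S(1) image_insert using fv.span_base[OF insertI1, of "r x" ?A] by simp
        moreover have "fv.independent (insert (r x) ?A)"
          using IH nsp' by (intro fv.independent_insertI) simp_all
        moreover have "inj_on r (insert x (U \<inter> S t))"
          using IH nA S(2) by (simp add: inj_on_insert)
        ultimately show ?thesis
          unfolding family_basis_def eq image_insert using S(1) by auto
      next
        case False
        then have eq: "U \<inter> S (Suc t) = U \<inter> S t" using S by auto
        \<comment> \<open>The dimension does not grow when \<open>x\<close> is added, so the old
          basis is still one by counting.\<close>
        have "family_basis r (S (Suc t)) (U \<inter> S t)"
          unfolding family_basis_iff[OF finS]
          using d eq Suc.IH[unfolded family_basis_iff[OF finS]] S by auto
        then show ?thesis using eq by simp
      qed
    qed
  qed
  \<comment> \<open>A bound above all values of \<open>p\<close>. For empty \<open>N\<close> the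
    maximum is unspecified, but \<open>S t\<close> is empty as well.\<close>
  define t where "t = Suc (Max (p ` N))"
  have "S t = N" using fin by (auto simp: S_def t_def less_Suc_eq_le)
  then show ?thesis using step[of t] U by (simp add: Int_absorb2)
qed

text \<open>A linear map cannot make dependent vectors independent. Rows that are independent after
  truncation are independent before it, and so extend to a basis.\<close>

lemma family_basis_lift:
  assumes "family_basis (trunc k \<circ> r) N I"
  obtains J where "I \<subseteq> J" "family_basis r N J"
proof -
  have I: "I \<subseteq> N" "inj_on (trunc k \<circ> r) I" "fv.independent (trunc k ` r ` I)"
    using assms by (auto simp: family_basis_def image_comp)
  have injr: "inj_on r I" using I(2) by (rule inj_on_imageI2)
  have injf: "inj_on (trunc k) (r ` I)" using I(2) by (rule inj_on_imageI)
  have "fv.independent (r ` I)"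
  proof
    assume "fv.dependent (r ` I)"
    then obtain a where a: "a \<in> r ` I" "a \<in> fv.span (r ` I - {a})"
      unfolding fv.dependent_def by blast
    have "trunc k a \<in> fv.span (trunc k ` (r ` I - {a}))" unfolding trunc.span_image using a(2) by blast
    also have "trunc k ` (r ` I - {a}) = trunc k ` r ` I - {trunc k a}"
      using inj_on_image_set_diff[OF injf, of "r ` I" "{a}"] a(1) by auto
    finally show False using I(3) a(1) unfolding fv.dependent_def by blast
  qed
  then show ?thesis using family_basis_extend[OF I(1) injr] that by blast
qed

text \<open>Spanning sets map to spanning sets, so the truncated rows of a basis can be thinned out
  to a basis of the truncated family.\<close>

lemma family_basis_project:
  assumes "family_basis r N I"
  obtains J where "J \<subseteq> I" "family_basis (trunc k \<circ> r) N J"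
proof -
  obtain J where J: "family_basis (trunc k \<circ> r) I J"
    using family_basis_extend[of "{}" I "trunc k \<circ> r"] fv.independent_empty by auto
  have "(trunc k \<circ> r) ` N \<subseteq> trunc k ` fv.span (r ` I)"
    using assms by (auto simp: family_basis_def)
  also have "\<dots> = fv.span ((trunc k \<circ> r) ` I)" by (simp only: trunc.span_image image_comp[symmetric])
  also have "\<dots> \<subseteq> fv.span ((trunc k \<circ> r) ` J)"
    using J by (metis family_basis_def fv.span_mono fv.span_span)
  finally have "family_basis (trunc k \<circ> r) N J"
    using J assms unfolding family_basis_def by blast
  moreover have "J \<subseteq> I" using J by (simp add: family_basis_def)
  ultimately show ?thesis using that by blast
qed

section \<open>Bases of a flag\<close>

definition flag_row :: "nat \<Rightarrow> (nat \<Rightarrow> complex vec set) \<Rightarrow> nat \<Rightarrow> nat \<Rightarrow> nat \<Rightarrow> complex" where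
  "flag_row n F k i = trunc k (\<lambda>j. flag_matrix n F $$ (i - 1, j))"

abbreviation flag_basis :: "nat \<Rightarrow> (nat \<Rightarrow> complex vec set) \<Rightarrow> nat \<Rightarrow> nat set \<Rightarrow> bool" where
  "flag_basis n F k I \<equiv> family_basis (flag_row n F k) {1..n} I"

lemma represents_flag_matrix: "F \<in> complete_flags n \<Longrightarrow> represents n (flag_matrix n F) F"
  unfolding flag_matrix_def using represents_ex by (rule someI_ex)

lemma flag_matrix_carrier: "F \<in> complete_flags n \<Longrightarrow> flag_matrix n F \<in> carrier_mat n n"
  using represents_flag_matrix by (simp add: represents_def)

lemma flag_rank_eq_dim:
  assumes F: "F \<in> complete_flags n" and k: "k \<le> n" and S: "S \<subseteq> {1..n}"
  shows "flag_rank n S F k = fv.dim (flag_row n F k ` S)"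
proof -
  have "{i. i < n \<and> Suc i \<in> S} = (\<lambda>i. i - 1) ` S"
  proof (intro subset_antisym subsetI)
    fix i assume "i \<in> {i. i < n \<and> Suc i \<in> S}"
    then show "i \<in> (\<lambda>i. i - 1) ` S" by (intro image_eqI[of _ _ "Suc i"]) auto
  next
    fix i assume "i \<in> (\<lambda>i. i - 1) ` S"
    then obtain s where "s \<in> S" "i = s - 1" by auto
    moreover from this have "1 \<le> s" "s \<le> n" using S by auto
    ultimately show "i \<in> {i. i < n \<and> Suc i \<in> S}" by auto
  qed
  then show ?thesis
    using rank_submatrix_eq_dim[OF flag_matrix_carrier[OF F] k, of "{i. Suc i \<in> S}"]
    by (simp add: flag_rank_def flag_row_def[abs_def] image_image)
qed

text \<open>The first \<open>k\<close> columns span \<open>F k\<close>, so their rank is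
  \<open>k\<close>, and this rank is also the dimension of the row span.\<close>

lemma dim_flag_rows:
  assumes F: "F \<in> complete_flags n" and k: "k \<le> n"
  shows "fv.dim (flag_row n F k ` {1..n}) = k"
proof -
  let ?A = "submatrix (flag_matrix n F) UNIV {..<k}"
  have M: "flag_matrix n F \<in> carrier_mat n n" using F by (rule flag_matrix_carrier)
  have Fk: "F k = vec_space.col_space n ?A"
    using represents_flag_matrix[OF F] k by (simp add: represents_def)
  have "vec_space.rank n ?A = k"
    using F k unfolding vec_space.rank_def vec_space.col_space_def[symmetric] Fk[symmetric]
    by (simp add: complete_flags_def)
  moreover have "dim_row ?A = n" using M by (simp add: dim_submatrix)
  moreover have "{i. i < n \<and> i \<in> UNIV} = (\<lambda>i. i - 1) ` {1..n}"
  proof (intro subset_antisym subsetI)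
    fix i assume "i \<in> {i. i < n \<and> i \<in> UNIV}"
    then show "i \<in> (\<lambda>i. i - 1) ` {1..n}" by (intro image_eqI[of _ _ "Suc i"]) auto
  qed auto
  ultimately show ?thesis
    using rank_submatrix_eq_dim[OF M k, of UNIV]
    by (simp add: flag_row_def[abs_def] image_image)
qed

lemma card_flag_basis:
  "F \<in> complete_flags n \<Longrightarrow> k \<le> n \<Longrightarrow> flag_basis n F k I \<Longrightarrow> card I = k"
  using family_basis_card dim_flag_rows by metis

text \<open>A product vanishes iff a factor does, and a minor of size \<open>k\<close> is nonzero
  iff its rows have rank \<open>k\<close>, the rank of all rows.\<close>

lemma multi_pluecker_nonzero_iff:
  assumes F: "F \<in> complete_flags n" and w: "w permutes {1..n}"
  shows "multi_pluecker n w F \<noteq> 0 \<longleftrightarrow> (\<forall>k\<in>{1..n}. flag_basis n F k (w ` {1..k}))"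
proof -
  have "flag_minor n (map w [1..<Suc k]) F \<noteq> 0 \<longleftrightarrow> flag_basis n F k (w ` {1..k})"
    if k: "k \<in> {1..n}" for k
  proof -
    let ?A = "mat k k (\<lambda>(i, j). flag_matrix n F $$ (w (Suc i) - 1, j))"
    have "mat k k (\<lambda>(r, c). flag_matrix n F $$ (map w [1..<Suc k] ! r - 1, c)) = ?A"
      by (rule eq_matI) (simp_all add: nth_upt del: upt_Suc)
    then have "flag_minor n (map w [1..<Suc k]) F = det ?A"
      by (simp add: flag_minor_def del: upt_Suc)
    moreover have "det ?A \<noteq> 0 \<longleftrightarrow> vec_space.rank k ?A = k"
      by (rule vec_space.det_rank_iff) simp
    moreover have "vec_space.rank k ?A = fv.dim (flag_row n F k ` w ` {1..k})"
    proof -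
      have "{1..k} = Suc ` {..<k}" by (simp add: image_Suc_lessThan)
      then show ?thesis
        using rank_mat_eq_dim[of k k "\<lambda>i j. flag_matrix n F $$ (w (Suc i) - 1, j)"]
        by (simp add: flag_row_def[abs_def] image_image)
    qed
    moreover have "k \<le> n" using k by simp
    ultimately show ?thesis
      using prefix_subset[OF w] card_prefix[OF w, of k] dim_flag_rows[OF F]
      by (auto simp: family_basis_iff)
  qed
  then show ?thesis by (simp add: multi_pluecker_def)
qed

lemma trunc_flag_row: "trunc k \<circ> flag_row n F (Suc k) = flag_row n F k"
  by (rule ext) (simp add: flag_row_def trunc_trunc)

text \<open>One-line notation under construction. A word of length \<open>n\<close> is a permutation
  whose multi-Pluecker coordinate does not vanish.\<close>

definition flag_word :: "nat \<Rightarrow> (nat \<Rightarrow> complex vec set) \<Rightarrow> nat list \<Rightarrow> bool" where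
  "flag_word n F xs \<longleftrightarrow> distinct xs \<and> (\<forall>l\<le>length xs. flag_basis n F l (set (take l xs)))"

lemma flag_word_snoc:
  assumes F: "F \<in> complete_flags n" and xs: "flag_word n F xs" and len: "Suc (length xs) \<le> n"
    and J: "flag_basis n F (Suc (length xs)) J" "set xs \<subseteq> J"
  obtains x where "flag_word n F (xs @ [x])" "set (xs @ [x]) = J"
proof -
  have d: "distinct xs" using xs by (simp add: flag_word_def)
  have cardJ: "card J = Suc (length xs)" using card_flag_basis[OF F len J(1)] .
  then have "finite J" by (simp add: card_ge_0_finite)
  have "card (set xs) = length xs" using d by (rule distinct_card)
  then have "card (J - set xs) = 1" using cardJ J(2) by (simp add: card_Diff_subset)
  then obtain x where x: "J - set xs = {x}" by (auto simp: card_1_singleton_iff)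
  then have Jx: "J = insert x (set xs)" "x \<notin> set xs" using J(2) by auto
  have "flag_basis n F l (set (take l (xs @ [x])))" if "l \<le> Suc (length xs)" for l
    using that J(1) xs Jx by (cases "l = Suc (length xs)") (auto simp: flag_word_def)
  then have "flag_word n F (xs @ [x])" using d Jx by (simp add: flag_word_def)
  then show ?thesis using that Jx by auto
qed

text \<open>By \<open>family_basis_project\<close> the basis loses one element at each step down
  from \<open>k\<close> to 0. The word lists these elements in reverse order of removal.\<close>

lemma flag_basis_word:
  assumes F: "F \<in> complete_flags n"
  shows "k \<le> n \<Longrightarrow> flag_basis n F k I \<Longrightarrow> \<exists>xs. flag_word n F xs \<and> length xs = k \<and> set xs = I"
proof (induction k arbitrary: I)
  case 0
  then have "card I = 0" using card_flag_basis[OF F] by blast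
  moreover have "finite I" using 0 finite_subset by (auto simp: family_basis_def)
  ultimately have "I = {}" by simp
  then show ?case using 0 by (intro exI[of _ "[]"]) (simp add: flag_word_def)
next
  case (Suc k)
  obtain J where J: "J \<subseteq> I" "flag_basis n F k J"
    using family_basis_project[OF Suc.prems(2), of k] unfolding trunc_flag_row by blast
  then obtain xs where xs: "flag_word n F xs" "length xs = k" "set xs = J"
    using Suc.IH Suc.prems(1) by fastforce
  obtain x where "flag_word n F (xs @ [x])" "set (xs @ [x]) = I"
    using flag_word_snoc[OF F xs(1), of I] xs J Suc.prems by auto
  then show ?case using xs(2) by (intro exI[of _ "xs @ [x]"]) simp
qed

lemma flag_word_extend:
  assumes F: "F \<in> complete_flags n"
  shows "flag_word n F xs \<Longrightarrow> length xs \<le> n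
    \<Longrightarrow> \<exists>ys. flag_word n F (xs @ ys) \<and> length (xs @ ys) = n"
proof (induction "n - length xs" arbitrary: xs)
  case 0
  then show ?case by (intro exI[of _ "[]"]) simp
next
  case (Suc d)
  have "\<forall>l\<le>length xs. flag_basis n F l (set (take l xs))"
    using Suc.prems(1) by (simp add: flag_word_def)
  from this[rule_format, of "length xs"] have "flag_basis n F (length xs) (set xs)" by simp
  then obtain J where J: "set xs \<subseteq> J" "flag_basis n F (Suc (length xs)) J"
    using family_basis_lift[of "length xs" "flag_row n F (Suc (length xs))"]
    unfolding trunc_flag_row by blast
  have "Suc (length xs) \<le> n" using Suc.hyps(2) by simp
  from flag_word_snoc[OF F Suc.prems(1) this J(2,1)]
  obtain x where x: "flag_word n F (xs @ [x])" .
  then obtain ys where "flag_word n F ((xs @ [x]) @ ys)" "length ((xs @ [x]) @ ys) = n"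
    using Suc.hyps(1)[of "xs @ [x]"] Suc.hyps(2) by fastforce
  then show ?case by (intro exI[of _ "x # ys"]) simp
qed

text \<open>Descend from \<open>I\<close> to the empty set, then ascend from \<open>I\<close> to all
  of \<open>[n]\<close>. This lets the vanishing of the coordinates constrain each basis of each
  \<open>F k\<close> separately.\<close>

lemma flag_basis_permutation:
  assumes F: "F \<in> complete_flags n" and k: "k \<le> n" and I: "flag_basis n F k I"
  obtains w where "w permutes {1..n}" "w ` {1..k} = I" "multi_pluecker n w F \<noteq> 0"
proof -
  obtain xs where xs: "flag_word n F xs" "length xs = k" "set xs = I"
    using flag_basis_word[OF F k I] by blast
  then obtain ys where ys: "flag_word n F (xs @ ys)" "length (xs @ ys) = n"
    using flag_word_extend[OF F xs(1)] k by blast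
  define zs where "zs = xs @ ys"
  have zs: "distinct zs" "length zs = n" "\<And>l. l \<le> n \<Longrightarrow> flag_basis n F l (set (take l zs))"
    using ys by (auto simp: zs_def flag_word_def)
  have "set zs \<subseteq> {1..n}" using zs(3)[of n] zs(2) by (simp add: family_basis_def)
  moreover have "card (set zs) = n" using zs(1,2) distinct_card by blast
  ultimately have set_zs: "set zs = {1..n}" by (intro card_subset_eq) auto
  define w where "w i = (if i \<in> {1..n} then zs ! (i - 1) else i)" for i
  have im: "w ` {1..l} = set (take l zs)" if l: "l \<le> n" for l
  proof -
    have "{1..l} = Suc ` {0..<l}" by (simp add: atLeastLessThanSuc_atLeastAtMost)
    then have "w ` {1..l} = (\<lambda>i. w (Suc i)) ` {0..<l}" by (simp only: image_image)
    also have "\<dots> = nth zs ` {0..<l}" using l by (intro image_cong) (auto simp: w_def)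
    also have "\<dots> = set (take l zs)" using l zs(2) by (intro nth_image) simp
    finally show ?thesis .
  qed
  have "w ` {1..n} = {1..n}" using im[of n] zs(2) set_zs by simp
  then have "bij_betw w {1..n} {1..n}" by (simp add: bij_betw_def eq_card_imp_inj_on)
  then have w: "w permutes {1..n}" by (rule bij_imp_permutes) (simp add: w_def del: atLeastAtMost_iff)
  moreover have "w ` {1..k} = I" using im[OF k] xs by (simp add: zs_def)
  moreover have "multi_pluecker n w F \<noteq> 0"
    unfolding multi_pluecker_nonzero_iff[OF F w] using im zs(3) by simp
  ultimately show ?thesis using that by blast
qed

section \<open>Cyclic intervals\<close>

definition cyc_pos :: "nat \<Rightarrow> nat \<Rightarrow> nat \<Rightarrow> nat" where
  "cyc_pos n r i = (i + n - r) mod n"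

lemma cyc_pos_eq:
  assumes "r \<in> {1..n}" "i \<in> {1..n}"
  shows "cyc_pos n r i = (if r \<le> i then i - r else i + n - r)"
  using assms by (auto simp: cyc_pos_def mod_if)

lemma cyc_pos_inj: "r \<in> {1..n} \<Longrightarrow> inj_on (cyc_pos n r) {1..n}"
  by (auto simp: inj_on_def cyc_pos_eq split: if_splits)

lemma cyc_pos_less: "r \<in> {1..n} \<Longrightarrow> cyc_pos n r i < n"
  by (auto simp: cyc_pos_def)

lemma cyc_pos_surj:
  assumes "r \<in> {1..n}" "t < n"
  obtains i where "i \<in> {1..n}" "cyc_pos n r i = t"
proof (cases "r + t \<le> n")
  case True
  then show ?thesis using that[of "r + t"] assms by (auto simp: cyc_pos_eq)
next
  case False
  then have "r + t - n \<in> {1..n}" "\<not> r \<le> r + t - n" using assms by auto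
  then show ?thesis using that[of "r + t - n"] cyc_pos_eq[OF assms(1)] False by simp
qed

lemma cyc_interval_eq_less:
  assumes "r \<in> {1..n}" "i \<in> {1..n}"
  shows "cyc_interval n r i = {x \<in> {1..n}. cyc_pos n r x < cyc_pos n r i}"
  using assms by (auto simp: cyc_interval_def cyc_pos_eq split: if_splits)

lemma cyc_interval_eq_ge:
  assumes "r \<in> {1..n}" "i \<in> {1..n}" "i \<noteq> r"
  shows "cyc_interval n i r = {x \<in> {1..n}. cyc_pos n r i \<le> cyc_pos n r x}"
  using assms by (auto simp: cyc_interval_def cyc_pos_eq split: if_splits)

lemma cyc_interval_subset: "r \<in> {1..n} \<Longrightarrow> i \<in> {1..n} \<Longrightarrow> cyc_interval n r i \<subseteq> {1..n}"
  by (auto simp: cyc_interval_def)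

lemma cyc_interval_self [simp]: "cyc_interval n r r = {}"
  by (simp add: cyc_interval_def)

text \<open>The counting form of the order on subsets of equal size: no proper initial segment of
  the order starting at \<open>r\<close> has more elements in \<open>B\<close> than in
  \<open>A\<close>.\<close>

definition cyc_dominates :: "nat \<Rightarrow> nat \<Rightarrow> nat set \<Rightarrow> nat set \<Rightarrow> bool" where
  "cyc_dominates n r A B \<longleftrightarrow>
     (\<forall>i\<in>{1..n}. card (B \<inter> cyc_interval n r i) \<le> card (A \<inter> cyc_interval n r i))"

text \<open>The \<open>m\<close>-th element of \<open>A\<close> comes no later than that of
  \<open>B\<close>, so it lies in every initial segment that contains the latter.\<close>

lemma cyc_subset_le_imp_dominates:
  assumes le: "cyc_subset_le n r A B" and r: "r \<in> {1..n}" and A: "A \<subseteq> {1..n}" and B: "B \<subseteq> {1..n}"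
  shows "cyc_dominates n r A B"
proof -
  obtain as bs where as: "set as = A" "sorted_wrt (cyc_less n r) as"
    and bs: "set bs = B" "sorted_wrt (cyc_less n r) bs"
    and all: "list_all2 (\<lambda>i j. cyc_less n r i j \<or> i = j) as bs"
    using le unfolding cyc_subset_le_def by blast
  have distinct: "distinct xs" if "sorted_wrt (cyc_less n r) xs" for xs
    using that unfolding distinct_conv_nth sorted_wrt_iff_nth_less cyc_less_def
    by (metis less_irrefl nat_neq_iff)
  have card: "card (set xs \<inter> {x \<in> {1..n}. cyc_pos n r x < t})
      = card {m. m < length xs \<and> cyc_pos n r (xs ! m) < t}"
    if "sorted_wrt (cyc_less n r) xs" "set xs \<subseteq> {1..n}" for xs t
  proof -
    have "set xs \<inter> {x \<in> {1..n}. cyc_pos n r x < t} = set (filter (\<lambda>x. cyc_pos n r x < t) xs)"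
      using that(2) by auto
    moreover have "card (set (filter (\<lambda>x. cyc_pos n r x < t) xs)) = length (filter (\<lambda>x. cyc_pos n r x < t) xs)"
      using distinct[OF that(1)] by (intro distinct_card distinct_filter)
    ultimately show ?thesis by (simp only: length_filter_conv_card)
  qed
  show ?thesis unfolding cyc_dominates_def
  proof
    fix i assume i: "i \<in> {1..n}"
    let ?t = "cyc_pos n r i"
    have "{m. m < length bs \<and> cyc_pos n r (bs ! m) < ?t}
        \<subseteq> {m. m < length as \<and> cyc_pos n r (as ! m) < ?t}"
      using all by (auto simp: list_all2_conv_all_nth cyc_less_def cyc_pos_def dest: order.strict_trans)
    then have "card {m. m < length bs \<and> cyc_pos n r (bs ! m) < ?t}
        \<le> card {m. m < length as \<and> cyc_pos n r (as ! m) < ?t}"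
      by (intro card_mono) auto
    then show "card (B \<inter> cyc_interval n r i) \<le> card (A \<inter> cyc_interval n r i)"
      unfolding cyc_interval_eq_less[OF r i] using card[OF as(2)] card[OF bs(2)] A B as(1) bs(1) by simp
  qed
qed

lemma card_Int_cyc_interval:
  assumes r: "r \<in> {1..n}" and i: "i \<in> {1..n}" and X: "X \<subseteq> {1..n}"
  shows "int (card (X \<inter> cyc_interval n r i)) = int (card (X \<inter> {1..i - 1}))
    - int (card (X \<inter> {1..r - 1})) + (if i < r then int (card X) else 0)"
proof -
  have split: "int (card (X \<inter> {1..<q})) = int (card (X \<inter> {1..<p})) + int (card (X \<inter> {p..<q}))"
    if "1 \<le> p" "p \<le> q" for p q
  proof -
    have "X \<inter> {1..<q} = (X \<inter> {1..<p}) \<union> (X \<inter> {p..<q})" using that by auto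
    moreover have "(X \<inter> {1..<p}) \<inter> (X \<inter> {p..<q}) = {}" by auto
    ultimately show ?thesis by (simp add: card_Un_disjoint)
  qed
  have ivl: "{1..m - 1} = {1..<m}" if "1 \<le> m" for m :: nat using that by auto
  have full: "X \<inter> {1..<Suc n} = X" using X by auto
  show ?thesis
  proof (cases "i < r")
    case True
    have "X \<inter> cyc_interval n r i = (X \<inter> {r..<Suc n}) \<union> (X \<inter> {1..<i})"
      using True by (auto simp: cyc_interval_def)
    moreover have "(X \<inter> {r..<Suc n}) \<inter> (X \<inter> {1..<i}) = {}" using True by auto
    ultimately have "card (X \<inter> cyc_interval n r i) = card (X \<inter> {r..<Suc n}) + card (X \<inter> {1..<i})"
      by (simp add: card_Un_disjoint)
    then show ?thesis using split[of r "Suc n"] True r i ivl full by simp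
  next
    case False
    then show ?thesis using split[of r i] r i ivl by (simp add: cyc_interval_def)
  qed
qed

text \<open>The counts of \<open>B\<close> and \<open>A\<close> in the segment from \<open>r\<close>
  to \<open>i\<close> differ by the excess at \<open>i - 1\<close> minus that at
  \<open>r - 1\<close>; the wrap-around terms cancel for sets of equal size. So domination says that
  the excess is maximal at \<open>r - 1\<close>.\<close>

lemma cyc_dominates_iff_excess:
  assumes r: "r \<in> {1..n}" and A: "A \<subseteq> {1..n}" and B: "B \<subseteq> {1..n}" and card: "card A = card B"
  shows "cyc_dominates n r A B \<longleftrightarrow> excess A B (r - 1) = qdeg n A B"
proof -
  have le: "card (B \<inter> cyc_interval n r i) \<le> card (A \<inter> cyc_interval n r i)
      \<longleftrightarrow> excess A B (i - 1) \<le> excess A B (r - 1)" if i: "i \<in> {1..n}" for i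
  proof -
    have "int (card (B \<inter> cyc_interval n r i)) - int (card (A \<inter> cyc_interval n r i))
        = excess A B (i - 1) - excess A B (r - 1)"
      unfolding card_Int_cyc_interval[OF r i A] card_Int_cyc_interval[OF r i B] excess_def card by simp
    then show ?thesis by linarith
  qed
  show ?thesis
  proof
    assume "cyc_dominates n r A B"
    then have dom: "excess A B (i - 1) \<le> excess A B (r - 1)" if "i \<in> {1..n}" for i
      using le that by (simp add: cyc_dominates_def)
    have "excess A B m \<le> excess A B (r - 1)" if "m \<le> n" for m
    \<comment> \<open>The index \<open>n\<close> is not of the form \<open>i - 1\<close>, but the
      excess there is 0 as at index 0.\<close>
    proof (cases "m = n")
      case True
      then show ?thesis using dom[of 1] r excess_full[OF A B card] by simp
    next
      case False
      then show ?thesis using dom[of "Suc m"] that by simp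
    qed
    then show "excess A B (r - 1) = qdeg n A B" using qdeg_eqI[of n A B _ "r - 1"] r by fastforce
  next
    assume "excess A B (r - 1) = qdeg n A B"
    then show "cyc_dominates n r A B"
      unfolding cyc_dominates_def using le excess_le_qdeg[of _ n A B] by fastforce
  qed
qed

lemma card_Int_cyc_interval_complement:
  assumes "r \<in> {1..n}" "i \<in> {1..n}" "i \<noteq> r" "X \<subseteq> {1..n}"
  shows "card (X \<inter> cyc_interval n i r) + card (X \<inter> cyc_interval n r i) = card X"
  using card_Int_cyc_interval[OF assms(1,2,4)] card_Int_cyc_interval[OF assms(2,1,4)] assms(3)
  by (auto split: if_splits)

text \<open>A final segment is the complement of an initial one, so the inequality turns around for
  sets of equal size. For \<open>i = r\<close> both intervals are empty.\<close>

lemma cyc_dominates_iff_final: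
  assumes r: "r \<in> {1..n}" and A: "A \<subseteq> {1..n}" and B: "B \<subseteq> {1..n}" and card: "card A = card B"
  shows "cyc_dominates n r A B
    \<longleftrightarrow> (\<forall>i\<in>{1..n}. card (A \<inter> cyc_interval n i r) \<le> card (B \<inter> cyc_interval n i r))"
  unfolding cyc_dominates_def
proof (intro ball_cong refl)
  fix i assume i: "i \<in> {1..n}"
  show "card (B \<inter> cyc_interval n r i) \<le> card (A \<inter> cyc_interval n r i)
    \<longleftrightarrow> card (A \<inter> cyc_interval n i r) \<le> card (B \<inter> cyc_interval n i r)"
  proof (cases "i = r")
    case False
    then show ?thesis
      using card_Int_cyc_interval_complement[OF r i False A]
        card_Int_cyc_interval_complement[OF r i False B] card by linarith
  qed simp
qed

section \<open>Tilted Richardson varieties\<close>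

text \<open>As \<open>u[k]\<close> dominates \<open>v[k]\<close> from \<open>a k\<close>, their
  excess is maximal at \<open>a k - 1\<close>. Equality in the triangle inequality is then decided
  at that index, by \<open>qdeg_additive_iff\<close>.\<close>

lemma tilted_interval_iff_dominates:
  assumes u: "u permutes {1..n}" and v: "v permutes {1..n}" and w: "w permutes {1..n}"
    and a: "\<forall>k\<in>{1..n}. a k \<in> {1..n}"
    and uv: "\<forall>k\<in>{1..n}. cyc_dominates n (a k) (u ` {1..k}) (v ` {1..k})"
  shows "w \<in> tilted_interval n u v
    \<longleftrightarrow> (\<forall>k\<in>{1..n}. cyc_dominates n (a k) (u ` {1..k}) (w ` {1..k})
          \<and> cyc_dominates n (a k) (w ` {1..k}) (v ` {1..k}))"
  unfolding tilted_interval_iff[OF u v w]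
proof (intro ball_cong refl)
  fix k assume k: "k \<in> {1..n}"
  then have ak: "a k \<in> {1..n}" and kn: "k \<le> n" using a by auto
  note iff = cyc_dominates_iff_excess[OF ak prefix_subset[OF _ kn] prefix_subset[OF _ kn]]
  have dom: "cyc_dominates n (a k) (x ` {1..k}) (y ` {1..k})
      \<longleftrightarrow> excess (x ` {1..k}) (y ` {1..k}) (a k - 1) = qdeg n (x ` {1..k}) (y ` {1..k})"
    if "x permutes {1..n}" "y permutes {1..n}" for x y
    using iff[OF that] card_prefix[OF that(1), of k] card_prefix[OF that(2), of k] by simp
  have "excess (u ` {1..k}) (v ` {1..k}) (a k - 1) = qdeg n (u ` {1..k}) (v ` {1..k})"
    using uv k dom[OF u v] by blast
  moreover have "a k - 1 \<le> n" using ak by auto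
  ultimately show "qdeg n (u ` {1..k}) (w ` {1..k}) + qdeg n (w ` {1..k}) (v ` {1..k})
      = qdeg n (u ` {1..k}) (v ` {1..k})
    \<longleftrightarrow> cyc_dominates n (a k) (u ` {1..k}) (w ` {1..k})
      \<and> cyc_dominates n (a k) (w ` {1..k}) (v ` {1..k})"
    unfolding dom[OF u w] dom[OF w v] by (intro qdeg_additive_iff)
qed

lemma flag_rank_le_iff:
  assumes F: "F \<in> complete_flags n" and k: "k \<le> n" and S: "S \<subseteq> {1..n}"
  shows "flag_rank n S F k \<le> m \<longleftrightarrow> (\<forall>I. flag_basis n F k I \<longrightarrow> card (I \<inter> S) \<le> m)"
  unfolding flag_rank_eq_dim[OF assms]
proof
  assume "fv.dim (flag_row n F k ` S) \<le> m"
  then show "\<forall>I. flag_basis n F k I \<longrightarrow> card (I \<inter> S) \<le> m"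
    using card_family_basis_Int_le[of "{1..n}" "flag_row n F k" _ S] S by fastforce
next
  assume all: "\<forall>I. flag_basis n F k I \<longrightarrow> card (I \<inter> S) \<le> m"
  obtain I where "flag_basis n F k I" "card (I \<inter> S) = fv.dim (flag_row n F k ` S)"
    using family_basis_attains_dim[of "{1..n}" S] S by blast
  then show "fv.dim (flag_row n F k ` S) \<le> m" using all by metis
qed

text \<open>A rank bound is a bound on the intersection with every basis. Initial segments compare
  the bases with \<open>u[k]\<close>, and final segments compare them with \<open>v[k]\<close>
  through \<open>cyc_dominates_iff_final\<close>.\<close>

lemma tilted_richardson_iff:
  assumes u: "u permutes {1..n}" and v: "v permutes {1..n}"
    and a: "\<forall>k\<in>{1..n}. a k \<in> {1..n}" and F: "F \<in> complete_flags n"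
  shows "F \<in> tilted_richardson n a u v
    \<longleftrightarrow> (\<forall>k\<in>{1..n}. \<forall>I. flag_basis n F k I \<longrightarrow>
          cyc_dominates n (a k) (u ` {1..k}) I \<and> cyc_dominates n (a k) I (v ` {1..k}))"
proof -
  have "(\<forall>i\<in>{1..n}. flag_rank n (cyc_interval n (a k) i) F k \<le> card (u ` {1..k} \<inter> cyc_interval n (a k) i)
        \<and> flag_rank n (cyc_interval n i (a k)) F k \<le> card (v ` {1..k} \<inter> cyc_interval n i (a k)))
      \<longleftrightarrow> (\<forall>I. flag_basis n F k I \<longrightarrow>
          cyc_dominates n (a k) (u ` {1..k}) I \<and> cyc_dominates n (a k) I (v ` {1..k}))"
    if k: "k \<in> {1..n}" for k
  proof -
    have ak: "a k \<in> {1..n}" and kn: "k \<le> n" using a k by auto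
    have dom: "cyc_dominates n (a k) I (v ` {1..k})
        \<longleftrightarrow> (\<forall>i\<in>{1..n}. card (I \<inter> cyc_interval n i (a k)) \<le> card (v ` {1..k} \<inter> cyc_interval n i (a k)))"
      if I: "flag_basis n F k I" for I
    proof (rule cyc_dominates_iff_final[OF ak _ prefix_subset[OF v kn]])
      show "I \<subseteq> {1..n}" using I by (simp add: family_basis_def)
      show "card I = card (v ` {1..k})" unfolding card_prefix[OF v] card_flag_basis[OF F kn I] ..
    qed
    have r: "flag_rank n (cyc_interval n (a k) i) F k \<le> m
        \<longleftrightarrow> (\<forall>I. flag_basis n F k I \<longrightarrow> card (I \<inter> cyc_interval n (a k) i) \<le> m)"
      "flag_rank n (cyc_interval n i (a k)) F k \<le> m
        \<longleftrightarrow> (\<forall>I. flag_basis n F k I \<longrightarrow> card (I \<inter> cyc_interval n i (a k)) \<le> m)"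
      if "i \<in> {1..n}" for i m
      using flag_rank_le_iff[OF F kn] cyc_interval_subset that ak by blast+
    show ?thesis using dom unfolding cyc_dominates_def[of n "a k" "u ` {1..k}"]
      by (simp only: r cong: ball_cong) blast
  qed
  then show ?thesis using F unfolding tilted_richardson_def by blast
qed

text \<open>Equal ranks are the hypothesis of \<open>family_basis_greedy\<close>, for the order
  starting at \<open>a k\<close> in the case of \<open>u[k]\<close> and for its reverse in the case
  of \<open>v[k]\<close>. Conversely, a basis bounds the ranks from below by its
  intersections.\<close>

lemma open_tilted_richardson_iff:
  assumes u: "u permutes {1..n}" and v: "v permutes {1..n}"
    and a: "\<forall>k\<in>{1..n}. a k \<in> {1..n}" and F: "F \<in> complete_flags n"
  shows "F \<in> open_tilted_richardson n a u v
    \<longleftrightarrow> F \<in> tilted_richardson n a u v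
      \<and> (\<forall>k\<in>{1..n}. flag_basis n F k (u ` {1..k}) \<and> flag_basis n F k (v ` {1..k}))"
proof
  assume L: "F \<in> open_tilted_richardson n a u v"
  have "flag_basis n F k (u ` {1..k}) \<and> flag_basis n F k (v ` {1..k})" if k: "k \<in> {1..n}" for k
  proof
    have r: "a k \<in> {1..n}" and kn: "k \<le> n" using a k by auto
    let ?p = "cyc_pos n (a k)"
    have full: "fv.dim (flag_row n F k ` {1..n}) = card (x ` {1..k} \<inter> {1..n})"
      if x: "x permutes {1..n}" for x
      using prefix_subset[OF x kn] by (simp only: Int_absorb2 card_prefix[OF x] dim_flag_rows[OF F kn])
    have empty: "fv.dim (flag_row n F k ` {}) = 0"
      using fv.dim_eq_card_independent[OF fv.independent_empty] by simp
    have pn: "?p x < n" for x using cyc_pos_less[OF r] .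
    show "flag_basis n F k (u ` {1..k})"
    proof (rule family_basis_greedy[where p = ?p])
      fix t
      show "fv.dim (flag_row n F k ` {x \<in> {1..n}. ?p x < t}) = card (u ` {1..k} \<inter> {x \<in> {1..n}. ?p x < t})"
      \<comment> \<open>For \<open>t \<ge> n\<close> the segment is all of \<open>[n]\<close>, which
        is no cyclic interval starting at \<open>a k\<close>; there the dimension is
        \<open>k\<close>.\<close>
      proof (cases "t < n")
        case True
        then obtain i where i: "i \<in> {1..n}" "?p i = t" using cyc_pos_surj[OF r] by blast
        then have S: "{x \<in> {1..n}. ?p x < t} = cyc_interval n (a k) i"
          using cyc_interval_eq_less[OF r] by simp
        show ?thesis
          using L i k flag_rank_eq_dim[OF F kn cyc_interval_subset[OF r i(1)]]
          unfolding S open_tilted_richardson_def by simp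
      next
        case False
        then have "?p x < t" for x using pn[of x] by linarith
        then have "{x \<in> {1..n}. ?p x < t} = {1..n}" by auto
        then show ?thesis using full[OF u] by simp
      qed
    qed (use cyc_pos_inj[OF r] prefix_subset[OF u kn] in auto)
    show "flag_basis n F k (v ` {1..k})"
    \<comment> \<open>Reversing the positions turns the final segments into initial ones.\<close>
    proof (rule family_basis_greedy[where p = "\<lambda>x. n - 1 - ?p x"])
      show "inj_on (\<lambda>x. n - 1 - ?p x) {1..n}"
      proof (rule inj_onI)
        fix x y assume "x \<in> {1..n}" "y \<in> {1..n}" "n - 1 - ?p x = n - 1 - ?p y"
        moreover from this have "?p x = ?p y" using pn[of x] pn[of y] by linarith
        ultimately show "x = y" using cyc_pos_inj[OF r] by (auto dest: inj_onD)
      qed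
      fix t
      have iff: "n - 1 - ?p x < t \<longleftrightarrow> n - t \<le> ?p x" if "0 < t" for x
        using pn[of x] that by linarith
      consider "t = 0" | "0 < t" "t < n" | "0 < t" "n \<le> t" by linarith
      then show "fv.dim (flag_row n F k ` {x \<in> {1..n}. n - 1 - ?p x < t})
          = card (v ` {1..k} \<inter> {x \<in> {1..n}. n - 1 - ?p x < t})"
      proof cases
        case 1
        then show ?thesis using empty by simp
      next
        case 2
        then obtain i where i: "i \<in> {1..n}" "?p i = n - t" using cyc_pos_surj[OF r, of "n - t"] by auto
        \<comment> \<open>The case \<open>i = a k\<close> has to be excluded: the interval from
          \<open>a k\<close> to itself is empty, while the final segment beginning there is
          everything.\<close>
        have "?p (a k) = 0" using cyc_pos_eq[OF r r] by simp
        then have "i \<noteq> a k" using i 2 by auto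
        then have S: "{x \<in> {1..n}. n - 1 - ?p x < t} = cyc_interval n i (a k)"
          using cyc_interval_eq_ge[OF r i(1)] i(2) 2 iff by simp
        show ?thesis
          using L i k flag_rank_eq_dim[OF F kn cyc_interval_subset[OF i(1) r]]
          unfolding S open_tilted_richardson_def by simp
      next
        case 3
        then have "{x \<in> {1..n}. n - 1 - ?p x < t} = {1..n}" using iff by auto
        then show ?thesis using full[OF v] by simp
      qed
    qed (use prefix_subset[OF v kn] in auto)
  qed
  moreover have "F \<in> tilted_richardson n a u v"
    using L by (auto simp: tilted_richardson_def open_tilted_richardson_def)
  ultimately show "F \<in> tilted_richardson n a u v
    \<and> (\<forall>k\<in>{1..n}. flag_basis n F k (u ` {1..k}) \<and> flag_basis n F k (v ` {1..k}))" by blast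
next
  assume R: "F \<in> tilted_richardson n a u v
    \<and> (\<forall>k\<in>{1..n}. flag_basis n F k (u ` {1..k}) \<and> flag_basis n F k (v ` {1..k}))"
  have ge: "card (I \<inter> S) \<le> flag_rank n S F k"
    if "flag_basis n F k I" "k \<in> {1..n}" "S \<subseteq> {1..n}" for I S k
    using card_family_basis_Int_le[OF _ that(1,3)] flag_rank_eq_dim[OF F _ that(3), of k] that(2) by simp
  have "flag_rank n (cyc_interval n (a k) i) F k = card (u ` {1..k} \<inter> cyc_interval n (a k) i) \<and>
     flag_rank n (cyc_interval n i (a k)) F k = card (v ` {1..k} \<inter> cyc_interval n i (a k))"
    if ik: "i \<in> {1..n}" "k \<in> {1..n}" for i k
  proof -
    have "a k \<in> {1..n}" using a ik by blast
    then have "cyc_interval n (a k) i \<subseteq> {1..n}" "cyc_interval n i (a k) \<subseteq> {1..n}"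
      using cyc_interval_subset ik by blast+
    then have "card (u ` {1..k} \<inter> cyc_interval n (a k) i) \<le> flag_rank n (cyc_interval n (a k) i) F k"
      "card (v ` {1..k} \<inter> cyc_interval n i (a k)) \<le> flag_rank n (cyc_interval n i (a k)) F k"
      using R ik ge by blast+
    moreover have "flag_rank n (cyc_interval n (a k) i) F k \<le> card (u ` {1..k} \<inter> cyc_interval n (a k) i)"
      "flag_rank n (cyc_interval n i (a k)) F k \<le> card (v ` {1..k} \<inter> cyc_interval n i (a k))"
      using R ik unfolding tilted_richardson_def by blast+
    ultimately show ?thesis by linarith
  qed
  then show "F \<in> open_tilted_richardson n a u v"
    using F unfolding open_tilted_richardson_def by blast
qed

theorem theorem4p12:
  fixes n :: nat and u v a :: "nat \<Rightarrow> nat"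
  assumes "u permutes {1..n}" and "v permutes {1..n}"
    and "\<forall>k\<in>{1..n}. a k \<in> {1..n}" and "tilted_le n a u v"
  shows "tilted_richardson n a u v =
           {F \<in> complete_flags n.
              \<forall>w. w permutes {1..n} \<and> w \<notin> tilted_interval n u v \<longrightarrow> multi_pluecker n w F = 0}
         \<and> open_tilted_richardson n a u v =
           tilted_richardson n a u v
             \<inter> {F. multi_pluecker n u F * multi_pluecker n v F \<noteq> 0}"
proof -
  have uv: "\<forall>k\<in>{1..n}. cyc_dominates n (a k) (u ` {1..k}) (v ` {1..k})"
  proof
    fix k assume k: "k \<in> {1..n}"
    then have "k \<le> n" by simp
    then show "cyc_dominates n (a k) (u ` {1..k}) (v ` {1..k})"
      using cyc_subset_le_imp_dominates prefix_subset assms k unfolding tilted_le_def by blast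
  qed
  note interval = tilted_interval_iff_dominates[OF assms(1,2) _ assms(3) uv]
  note closed = tilted_richardson_iff[OF assms(1,2,3)]
  have "F \<in> tilted_richardson n a u v
      \<longleftrightarrow> (\<forall>w. w permutes {1..n} \<and> w \<notin> tilted_interval n u v \<longrightarrow> multi_pluecker n w F = 0)"
    if F: "F \<in> complete_flags n" for F
  proof
    assume T: "F \<in> tilted_richardson n a u v"
    show "\<forall>w. w permutes {1..n} \<and> w \<notin> tilted_interval n u v \<longrightarrow> multi_pluecker n w F = 0"
    proof (intro allI impI, rule ccontr)
      fix w assume w: "w permutes {1..n} \<and> w \<notin> tilted_interval n u v" "multi_pluecker n w F \<noteq> 0"
      then have "\<forall>k\<in>{1..n}. flag_basis n F k (w ` {1..k})"
        using multi_pluecker_nonzero_iff[OF F] by blast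
      then show False using w(1) T interval closed[OF F] by blast
    qed
  next
    assume zero: "\<forall>w. w permutes {1..n} \<and> w \<notin> tilted_interval n u v \<longrightarrow> multi_pluecker n w F = 0"
    show "F \<in> tilted_richardson n a u v" unfolding closed[OF F]
    proof (intro ballI allI impI)
      fix k I assume k: "k \<in> {1..n}" and I: "flag_basis n F k I"
      have kn: "k \<le> n" using k by simp
      \<comment> \<open>The nonvanishing coordinate forces \<open>w\<close> into the interval, and
        domination at \<open>k\<close> for \<open>w\<close> is domination for
        \<open>I\<close>.\<close>
      obtain w where w: "w permutes {1..n}" "w ` {1..k} = I" "multi_pluecker n w F \<noteq> 0"
        by (rule flag_basis_permutation[OF F kn I])
      then have "w \<in> tilted_interval n u v" using zero by blast
      then show "cyc_dominates n (a k) (u ` {1..k}) I \<and> cyc_dominates n (a k) I (v ` {1..k})"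
        using interval[OF w(1)] k w(2) by blast
    qed
  qed
  moreover have "F \<in> complete_flags n" if "F \<in> tilted_richardson n a u v" for F
    using that by (simp add: tilted_richardson_def)
  moreover have "F \<in> complete_flags n" if "F \<in> open_tilted_richardson n a u v" for F
    using that by (simp add: open_tilted_richardson_def)
  moreover have "F \<in> open_tilted_richardson n a u v
      \<longleftrightarrow> F \<in> tilted_richardson n a u v \<and> multi_pluecker n u F * multi_pluecker n v F \<noteq> 0"
    if F: "F \<in> complete_flags n" for F
    using open_tilted_richardson_iff[OF assms(1,2,3) F] multi_pluecker_nonzero_iff[OF F assms(1)]
      multi_pluecker_nonzero_iff[OF F assms(2)] by (simp only: mult_eq_0_iff de_Morgan_disj) blast
  ultimately show ?thesis by blast
qed

end
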